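(* Let $\Sigma$ be a full-rank covariance matrix on $\mathbb{R}^d\times\mathbb{R}^d$ (i.e. $\Sigma\in S_{2d}^{++}(\mathbb{R})$) and let $\varepsilon>0$. Then, for any pair of centered Gaussian measures $\mu=N_d(A)$ and $\nu=N_d(B)$ with non-singular covariances $A$ and $B$, the regularized optimal transport problem $$\inf_{\pi\in\Pi(\mu,\nu)}\int_{\mathbb{R}^d\times\mathbb{R}^d}\|x-y\|^2\,d\pi(x,y)+2\varepsilon\,\mathrm{KL}(\pi\,|\,N_{2d}(\Sigma))$$ has a unique solution.
   Context: $S_{2d}^{++}(\mathbb{R})$ is the set of real symmetric positive-definite $2d\times 2d$ matrices. $N_d(A)$ denotes the centered Gaussian measure on $\mathbb{R}^d$ with covariance $A$, and $N_{2d}(\Sigma)$ the centered Gaussian measure on $\mathbb{R}^d\times\mathbb{R}^d$ with covariance $\Sigma$. $\Pi(\mu,\nu)$ is the set of probability measures on $\mathbb{R}^d\times\mathbb{R}^d$ with first marginal $\mu$ and second marginal $\nu$. $\mathrm{KL}(\pi|\pi_{\mathrm{ref}}):=\int\log\left(\frac{d\pi}{d\pi_{\mathrm{ref}}}\right)d\pi$ if $\pi$ is absolutely continuous with respect to $\pi_{\mathrm{ref}}$, and $+\infty$ otherwise. *)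

theory Defs
  imports "HOL-Probability.Probability"
begin

text \<open>Covariance matrices, possibly singular: real symmetric positive-semidefinite matrices.\<close>

definition covariance_matrix :: "real^'n^'n \<Rightarrow> bool" where
  "covariance_matrix A \<longleftrightarrow> transpose A = A \<and> (\<forall>x. 0 \<le> x \<bullet> (A *v x))"

definition sym_pos_def :: "real^'n^'n \<Rightarrow> bool" where
  "sym_pos_def A \<longleftrightarrow> transpose A = A \<and> (\<forall>x. x \<noteq> 0 \<longrightarrow> 0 < x \<bullet> (A *v x))"

text \<open>The centered Gaussian measure with covariance \<open>A\<close>, given by its Lebesgue density; meaningful
  for non-singular covariance matrices \<open>A\<close> only.\<close>

definition gaussian_density :: "real^'n^'n \<Rightarrow> real^'n \<Rightarrow> real" where
  "gaussian_density A x =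
     exp (- (x \<bullet> (matrix_inv A *v x)) / 2) / sqrt ((2 * pi) ^ CARD('n) * det A)"

definition gaussian :: "real^'n^'n \<Rightarrow> (real^'n) measure" where
  "gaussian A = density lborel (\<lambda>x. ennreal (gaussian_density A x))"

text \<open>A \<open>2d \<times> 2d\<close> matrix is indexed by the sum type \<open>'d + 'd\<close>; the \<open>Inl\<close> coordinates
  form the first factor of the product space and the \<open>Inr\<close> coordinates the second.\<close>

definition split_vec :: "real^('d::finite + 'd) \<Rightarrow> (real^'d) \<times> (real^'d)" where
  "split_vec z = (\<chi> i. z $ Inl i, \<chi> i. z $ Inr i)"

definition gaussian_pair ::
    "real^('d::finite + 'd)^('d + 'd) \<Rightarrow> ((real^'d) \<times> (real^'d)) measure" where
  "gaussian_pair S = distr (gaussian S) borel split_vec"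

definition couplings :: "'a measure \<Rightarrow> 'b measure \<Rightarrow> ('a \<times> 'b) measure set" where
  "couplings \<mu> \<nu> = {p. prob_space p \<and> sets p = sets (\<mu> \<Otimes>\<^sub>M \<nu>) \<and>
                         distr p \<mu> fst = \<mu> \<and> distr p \<nu> snd = \<nu>}"

text \<open>\<open>KL p r\<close> is the divergence of \<open>p\<close> from the reference measure \<open>r\<close>. The library function
  \<^const>\<open>KL_divergence\<close> (which takes the reference measure first) is a real-valued Bochner
  integral, hence 0 when the log-density is not integrable. Here the integral is
  extended-real-valued: integral of the positive part minus integral of the negative part. For
  probability measures the latter is finite. The function \<^const>\<open>entropy_density\<close> to base
  \<open>exp 1\<close> is the natural logarithm of the density of \<open>p\<close> with respect to \<open>r\<close>.\<close>

definition KL :: "'a measure \<Rightarrow> 'a measure \<Rightarrow> ereal" where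
  "KL p r =
     (if absolutely_continuous r p
      then enn2ereal (\<integral>\<^sup>+ z. ennreal (entropy_density (exp 1) r p z) \<partial>p)
           - enn2ereal (\<integral>\<^sup>+ z. ennreal (- entropy_density (exp 1) r p z) \<partial>p)
      else \<infinity>)"

definition regularized_cost ::
    "real \<Rightarrow> ('a::real_normed_vector \<times> 'a) measure \<Rightarrow> ('a \<times> 'a) measure \<Rightarrow> ereal" where
  "regularized_cost \<epsilon> r p =
     enn2ereal (\<integral>\<^sup>+ (x, y). ennreal ((norm (x - y))\<^sup>2) \<partial>p) + ereal (2 * \<epsilon>) * KL p r"

end

theory Submission
  imports Defs
begin

text \<open>The problem is an entropic projection onto a convex set, and it is solved by the direct method
  in L1 of the reference measure \<open>r\<close>. A coupling of finite cost has a density \<open>f\<close> with respect to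
  \<open>r\<close>, and its cost is then \<open>\<integral> c f + 2 \<epsilon> \<phi>(f) dr\<close>, where \<open>c(x, y) = \<parallel>x - y\<parallel>\<^sup>2\<close> and
  \<open>\<phi>(t) = t ln t - t + 1 \<ge> 0\<close> (lemmas \<open>KL_density\<close> and \<open>regularized_cost_density\<close>). The function \<open>\<phi>\<close>
  is strictly convex in a quantitative way, lemma \<open>abs_diff_le_entropy_midpoint_gap\<close>: the convexity gap
  at the midpoint of two densities controls their L1 distance. Since the midpoint of two couplings
  is a coupling, two couplings whose costs are close to the infimum have densities close in L1
  (\<open>near_minimizers_L1_close\<close>). This gives uniqueness at once. It also shows that minimizing sequences
  are Cauchy; the marginal constraints pass to the L1 limit and Fatou's lemma shows that the limit
  is optimal (\<open>penalized_integral_minimizer_exists\<close>).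

  The argument requires one coupling of finite cost, and this is where the Gaussians enter. The
  product of the marginals is such a coupling, because log-densities of non-degenerate Gaussians grow
  quadratically and Gaussians have second moments (\<open>gaussian_product_cost_finite\<close>). It also requires
  that the densities defining the Gaussians are normalized. Both facts reduce to the standard Gaussian
  by a linear change of variables (\<open>nn_integral_lborel_linear\<close>) along a basis that is orthonormal for
  the inverse covariance (\<open>sym_pos_def_conjugate_identity\<close>).\<close>

section \<open>Minimizing an entropy-penalized integral over probability densities\<close>

text \<open>The correction \<open>- t + 1\<close> integrates to zero when \<open>t\<close> is the density of one probability measure
  with respect to another, and it makes the integrand nonnegative, so that the divergence becomes
  a single \<open>[0, \<infinity>]\<close>-valued integral instead of a difference of two.\<close>

definition entropy_fun :: "real \<Rightarrow> real" where
  "entropy_fun t = t * ln t - t + 1"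

text \<open>This is \<open>ln u \<le> u - 1\<close> at \<open>u = sqrt (m / s)\<close>. Using the square root is what turns relative
  entropy into a bound on \<open>(sqrt s - sqrt m)\<^sup>2\<close> below.\<close>

lemma mult_ln_ratio_ge:
  fixes s m :: real
  assumes "0 \<le> s" "0 < m"
  shows "2 * s - 2 * sqrt s * sqrt m \<le> s * ln s - s * ln m"
proof (cases "s = 0")
  case False
  with assms have s: "0 < s" by simp
  define u where "u = sqrt m / sqrt s"
  have u: "0 < u" using s assms by (simp add: u_def)
  have "ln u = (ln m - ln s) / 2"
    using s assms by (simp add: u_def ln_div ln_sqrt field_simps)
  moreover have "ln u \<le> u - 1" using u by (rule ln_le_minus_one)
  ultimately have "ln s - ln m \<ge> 2 - 2 * u" by simp
  then have "s * (2 - 2 * u) \<le> s * (ln s - ln m)"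
    using s by (intro mult_left_mono) auto
  moreover have "s * u = sqrt s * sqrt m"
    using s by (simp add: u_def field_simps)
  ultimately show ?thesis by (simp add: algebra_simps)
qed simp

lemma entropy_fun_nonneg: "0 \<le> t \<Longrightarrow> 0 \<le> entropy_fun t"
proof -
  assume t: "0 \<le> t"
  have "2 * t - 2 * sqrt t \<le> t * ln t"
    using mult_ln_ratio_ge[of t 1] t by simp
  moreover have "0 \<le> (sqrt t - 1)\<^sup>2" by simp
  then have "2 * sqrt t \<le> t + 1" using t by (simp add: power2_eq_square algebra_simps)
  ultimately show ?thesis by (simp add: entropy_fun_def)
qed

lemma entropy_fun_measurable [measurable]: "entropy_fun \<in> borel_measurable borel"
  unfolding entropy_fun_def by measurable

text \<open>Only the limit \<open>0\<close> needs an argument; there \<open>t ln t\<close> is squeezed between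
  \<open>2 t - 2 sqrt t\<close> and \<open>t (t - 1)\<close>.\<close>

lemma entropy_fun_tendsto:
  assumes "X \<longlonglongrightarrow> t" and nonneg: "\<And>n. 0 \<le> X n"
  shows "(\<lambda>n. entropy_fun (X n)) \<longlonglongrightarrow> entropy_fun t"
proof (cases "t = 0")
  case True
  have "(\<lambda>n. X n * ln (X n)) \<longlonglongrightarrow> 0"
  proof (rule tendsto_sandwich)
    show "\<forall>\<^sub>F n in sequentially. 2 * X n - 2 * sqrt (X n) \<le> X n * ln (X n)"
      using mult_ln_ratio_ge[of _ 1] nonneg by simp
    show "\<forall>\<^sub>F n in sequentially. X n * ln (X n) \<le> X n * (X n - 1)"
    proof (intro always_eventually allI)
      fix n show "X n * ln (X n) \<le> X n * (X n - 1)"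
        using nonneg[of n] ln_le_minus_one[of "X n"]
        by (cases "X n = 0") (auto intro!: mult_left_mono)
    qed
    show "(\<lambda>n. 2 * X n - 2 * sqrt (X n)) \<longlonglongrightarrow> 0"
      using assms(1) True by (auto intro!: tendsto_eq_intros)
    show "(\<lambda>n. X n * (X n - 1)) \<longlonglongrightarrow> 0"
      using assms(1) True by (auto intro!: tendsto_eq_intros)
  qed
  then have "(\<lambda>n. X n * ln (X n) - X n + 1) \<longlonglongrightarrow> 0 - t + 1"
    by (intro tendsto_add tendsto_diff tendsto_const assms(1))
  then show ?thesis using True by (simp add: entropy_fun_def)
next
  case False
  then show ?thesis
    using assms(1) unfolding entropy_fun_def by (auto intro!: tendsto_intros)
qed

text \<open>Quantitative strict convexity. With \<open>m\<close> the midpoint, twice the convexity gap is the sum of the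
  relative entropies of \<open>s\<close> and of \<open>t\<close> with respect to \<open>m\<close>, hence at least
  \<open>(sqrt s - sqrt m)\<^sup>2 + (sqrt t - sqrt m)\<^sup>2 \<ge> (sqrt s - sqrt t)\<^sup>2 / 2\<close>; and
  \<open>\<bar>s - t\<bar> = \<bar>sqrt s - sqrt t\<bar> (sqrt s + sqrt t)\<close> splits by Young's inequality with weight \<open>l\<close>.
  Keeping \<open>l\<close> free makes the bound linear in the gap, so that it can be integrated termwise.\<close>

lemma abs_diff_le_entropy_midpoint_gap:
  fixes s t l :: real
  assumes "0 \<le> s" "0 \<le> t" "0 < l"
  shows "\<bar>s - t\<bar> \<le> 4 / l * ((entropy_fun s + entropy_fun t) / 2 - entropy_fun ((s + t) / 2))
                     + l * (s + t) / 2"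
proof (cases "s + t = 0")
  case True
  then show ?thesis using assms by (simp add: add_nonneg_eq_0_iff entropy_fun_def)
next
  case False
  define m where "m = (s + t) / 2"
  define a b c where "a = sqrt s" and "b = sqrt t" and "c = sqrt m"
  define gap where "gap = (entropy_fun s + entropy_fun t) / 2 - entropy_fun m"
  have m: "0 < m" using False assms by (simp add: m_def)
  have sq: "s = a\<^sup>2" "t = b\<^sup>2" "m = c\<^sup>2"
    using assms m by (simp_all add: a_def b_def c_def)
  have ab: "0 \<le> a" "0 \<le> b" using assms by (auto simp: a_def b_def)
  have "(a - c)\<^sup>2 + (b - c)\<^sup>2 = (2 * s - 2 * a * c) + (2 * t - 2 * b * c)"
  proof -
    have "a\<^sup>2 + b\<^sup>2 = 2 * c\<^sup>2" using sq by (simp add: m_def)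
    then show ?thesis unfolding sq by (simp add: power2_eq_square algebra_simps)
  qed
  also have "\<dots> \<le> (s * ln s - s * ln m) + (t * ln t - t * ln m)"
    using mult_ln_ratio_ge[of s m] mult_ln_ratio_ge[of t m] assms m
    unfolding a_def b_def c_def by linarith
  also have "\<dots> = 2 * gap"
    by (simp add: gap_def entropy_fun_def m_def field_simps)
  finally have "(a - c)\<^sup>2 + (b - c)\<^sup>2 \<le> 2 * gap" .
  moreover have "(a - b)\<^sup>2 \<le> 2 * ((a - c)\<^sup>2 + (b - c)\<^sup>2)"
  proof -
    have "2 * ((a - c)\<^sup>2 + (b - c)\<^sup>2) = (a - b)\<^sup>2 + (a + b - 2 * c)\<^sup>2"
      by (simp add: power2_eq_square algebra_simps)
    then show ?thesis by simp
  qed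
  ultimately have gap: "(a - b)\<^sup>2 \<le> 4 * gap" by simp
  have "\<bar>s - t\<bar> = \<bar>a - b\<bar> * (a + b)"
  proof -
    have "s - t = (a - b) * (a + b)" unfolding sq by (simp add: power2_eq_square algebra_simps)
    then show ?thesis using ab by (simp add: abs_mult)
  qed
  also have "\<dots> \<le> (a - b)\<^sup>2 / l + l * (a + b)\<^sup>2 / 4"
  proof -
    \<comment> \<open>Young's inequality, cleared of denominators\<close>
    have "0 \<le> (2 * \<bar>a - b\<bar> - l * (a + b))\<^sup>2" by simp
    then have "4 * l * (\<bar>a - b\<bar> * (a + b)) \<le> 4 * (a - b)\<^sup>2 + l\<^sup>2 * (a + b)\<^sup>2"
      by (simp only: power2_diff power_mult_distrib power2_abs) (simp add: algebra_simps)
    then show ?thesis using \<open>0 < l\<close> by (simp add: field_simps power2_eq_square)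
  qed
  also have "\<dots> \<le> 4 * gap / l + l * (s + t) / 2"
  proof -
    have "(a + b)\<^sup>2 \<le> 2 * (s + t)"
      using zero_le_power2[of "a - b"] unfolding sq by (simp add: power2_eq_square algebra_simps)
    then have "l * (a + b)\<^sup>2 \<le> l * (2 * (s + t))"
      using \<open>0 < l\<close> by (intro mult_left_mono) auto
    then have "l * (a + b)\<^sup>2 / 4 \<le> l * (s + t) / 2" by (simp add: algebra_simps)
    moreover have "(a - b)\<^sup>2 / l \<le> 4 * gap / l"
      using gap \<open>0 < l\<close> by (simp add: divide_right_mono)
    ultimately show ?thesis by linarith
  qed
  finally show ?thesis by (simp add: gap_def m_def)
qed

definition penalized_integral ::
    "real \<Rightarrow> ('a \<Rightarrow> real) \<Rightarrow> 'a measure \<Rightarrow> ('a \<Rightarrow> real) \<Rightarrow> ennreal" where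
  "penalized_integral k c M f = (\<integral>\<^sup>+ z. ennreal (c z * f z + k * entropy_fun (f z)) \<partial>M)"

definition prob_density :: "'a measure \<Rightarrow> ('a \<Rightarrow> real) \<Rightarrow> bool" where
  "prob_density M f \<longleftrightarrow> f \<in> borel_measurable M \<and> (\<forall>z. 0 \<le> f z) \<and> (\<integral>\<^sup>+ z. ennreal (f z) \<partial>M) = 1"

text \<open>If \<open>f\<close> and \<open>g\<close> are both within \<open>d\<close> of a lower bound \<open>m\<close> for the functional at their midpoint,
  then the integrated convexity gap is at most \<open>d\<close>, and strict convexity keeps \<open>f\<close> and \<open>g\<close> close in
  L1. For small \<open>d\<close> this makes minimizing sequences Cauchy; for \<open>d = 0\<close> it gives uniqueness. The cost
  \<open>c\<close> enters linearly and drops out of the gap.\<close>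

lemma near_minimizers_L1_close:
  fixes c :: "'a \<Rightarrow> real"
  assumes c [measurable]: "c \<in> borel_measurable M" and c0: "\<And>z. 0 \<le> c z" and k: "0 < k"
    and f: "prob_density M f" and g: "prob_density M g"
    and m: "m \<le> penalized_integral k c M (\<lambda>z. (f z + g z) / 2)" "m < \<infinity>"
    and fm: "penalized_integral k c M f \<le> m + ennreal d"
    and gm: "penalized_integral k c M g \<le> m + ennreal d"
    and d: "0 \<le> d" and l: "0 < l"
  shows "(\<integral>\<^sup>+ z. ennreal \<bar>f z - g z\<bar> \<partial>M) \<le> ennreal (4 * d / (k * l) + l)"
proof -
  have [measurable]: "f \<in> borel_measurable M" "g \<in> borel_measurable M"
    and nn: "\<And>z. 0 \<le> f z" "\<And>z. 0 \<le> g z"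
    and int: "(\<integral>\<^sup>+ z. ennreal (f z) \<partial>M) = 1" "(\<integral>\<^sup>+ z. ennreal (g z) \<partial>M) = 1"
    using f g by (auto simp: prob_density_def)
  define h where "h z t = c z * t + k * entropy_fun t" for z t
  \<comment> \<open>\<open>4 / l\<close> times the midpoint gap of \<open>entropy_fun\<close> is \<open>2 * a\<close> times that of \<open>h z\<close>\<close>
  define a where "a = 2 / (k * l)"
  have a: "0 < a" using k l by (simp add: a_def)
  have h0: "0 \<le> h z t" if "0 \<le> t" for z t
    using c0 k entropy_fun_nonneg that by (simp add: h_def)
  have hm [measurable]: "(\<lambda>z. h z (u z)) \<in> borel_measurable M"
    if [measurable]: "u \<in> borel_measurable M" for u
    unfolding h_def by measurable
  have pt: "\<bar>s - t\<bar> + 2 * a * h z ((s + t) / 2) \<le> a * (h z s + h z t) + l / 2 * (s + t)"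
    if "0 \<le> s" "0 \<le> t" for s t z
  proof -
    have "\<bar>s - t\<bar> \<le> 4 / l * ((entropy_fun s + entropy_fun t) / 2 - entropy_fun ((s + t) / 2))
                     + l * (s + t) / 2"
      by (rule abs_diff_le_entropy_midpoint_gap[OF that l])
    also have "4 / l * ((entropy_fun s + entropy_fun t) / 2 - entropy_fun ((s + t) / 2))
        = a * (h z s + h z t) - 2 * a * h z ((s + t) / 2)"
      using k l by (simp add: h_def a_def field_simps)
    finally show ?thesis by simp
  qed
  let ?I = "\<integral>\<^sup>+ z. ennreal \<bar>f z - g z\<bar> \<partial>M"
  have "?I + ennreal (2 * a) * m
      \<le> ?I + ennreal (2 * a) * (\<integral>\<^sup>+ z. ennreal (h z ((f z + g z) / 2)) \<partial>M)"
    using m(1) unfolding penalized_integral_def h_def by (intro add_mono mult_left_mono) auto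
  also have "\<dots> = (\<integral>\<^sup>+ z. ennreal (\<bar>f z - g z\<bar> + 2 * a * h z ((f z + g z) / 2)) \<partial>M)"
    using a nn by (simp add: nn_integral_add nn_integral_cmult ennreal_plus ennreal_mult h0)
  also have "\<dots> \<le> (\<integral>\<^sup>+ z. ennreal (a * (h z (f z) + h z (g z)) + l / 2 * (f z + g z)) \<partial>M)"
    using pt nn by (intro nn_integral_mono ennreal_leI) auto
  also have "\<dots> = ennreal a * (penalized_integral k c M f + penalized_integral k c M g)
                    + ennreal (l / 2) * (1 + 1)"
  proof -
    have "(\<integral>\<^sup>+ z. ennreal (a * (h z (f z) + h z (g z)) + l / 2 * (f z + g z)) \<partial>M)
        = (\<integral>\<^sup>+ z. ennreal a * (ennreal (h z (f z)) + ennreal (h z (g z)))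
                + ennreal (l / 2) * (ennreal (f z) + ennreal (g z)) \<partial>M)"
      using a l nn h0
      by (intro nn_integral_cong)
        (simp only: ennreal_plus ennreal_mult add_nonneg_nonneg mult_nonneg_nonneg less_imp_le half_gt_zero)
    also have "\<dots> = ennreal a * ((\<integral>\<^sup>+ z. ennreal (h z (f z)) \<partial>M) + (\<integral>\<^sup>+ z. ennreal (h z (g z)) \<partial>M))
                + ennreal (l / 2) * ((\<integral>\<^sup>+ z. ennreal (f z) \<partial>M) + (\<integral>\<^sup>+ z. ennreal (g z) \<partial>M))"
      by (simp add: nn_integral_add nn_integral_cmult)
    finally show ?thesis unfolding int penalized_integral_def h_def .
  qed
  also have "\<dots> \<le> ennreal a * ((m + ennreal d) + (m + ennreal d)) + ennreal (l / 2) * (1 + 1)"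
    by (intro add_mono mult_left_mono fm gm) auto
  also have "\<dots> = ennreal (4 * d / (k * l) + l) + ennreal (2 * a) * m"
  proof -
    obtain m' where m': "m = ennreal m'" "0 \<le> m'"
      using m(2) by (cases m) auto
    have two: "ennreal (l / 2) * (1 + 1) = ennreal l"
      unfolding distrib_left mult_1_right using l by (simp flip: ennreal_plus)
    show ?thesis
      unfolding m' two using m' a d l k
      by (simp flip: ennreal_plus ennreal_mult add: a_def field_simps)
  qed
  finally have "?I + ennreal (2 * a) * m \<le> ennreal (4 * d / (k * l) + l) + ennreal (2 * a) * m" .
  moreover have "ennreal (2 * a) * m < \<infinity>"
    using m(2) by (simp add: ennreal_mult_less_top)
  ultimately show ?thesis
    by (auto simp: ennreal_add_left_cancel_le add.commute)
qed

text \<open>Fatou's lemma in the form used for lower semicontinuity: it is applied both to the functional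
  and to the L1 distance.\<close>

lemma nn_integral_lower_limit:
  fixes U :: "nat \<Rightarrow> 'a \<Rightarrow> real"
  assumes [measurable]: "\<And>n. U n \<in> borel_measurable M"
    and "AE z in M. (\<lambda>n. U n z) \<longlonglongrightarrow> u z"
    and "\<And>n. N \<le> n \<Longrightarrow> (\<integral>\<^sup>+ z. ennreal (U n z) \<partial>M) \<le> b n" and "b \<longlonglongrightarrow> B"
  shows "(\<integral>\<^sup>+ z. ennreal (u z) \<partial>M) \<le> B"
proof -
  have "(\<integral>\<^sup>+ z. ennreal (u z) \<partial>M) = (\<integral>\<^sup>+ z. liminf (\<lambda>n. ennreal (U n z)) \<partial>M)"
    using assms(2)
    by (intro nn_integral_cong_AE) (auto intro!: lim_imp_Liminf[symmetric] tendsto_ennrealI)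
  also have "\<dots> \<le> liminf (\<lambda>n. \<integral>\<^sup>+ z. ennreal (U n z) \<partial>M)"
    by (intro nn_integral_liminf) auto
  also have "\<dots> \<le> liminf b"
    using assms(3) by (intro Liminf_mono) (auto simp: eventually_sequentially)
  also have "\<dots> = B" using assms(4) by (intro lim_imp_Liminf) auto
  finally show ?thesis .
qed

text \<open>The increments have a summable integral, so their sum is finite almost everywhere.\<close>

lemma AE_convergent_of_summable_L1:
  fixes F :: "nat \<Rightarrow> 'a \<Rightarrow> real"
  assumes [measurable]: "\<And>n. F n \<in> borel_measurable M"
    and "\<And>n. (\<integral>\<^sup>+ z. ennreal \<bar>F n z - F (Suc n) z\<bar> \<partial>M) \<le> ennreal ((1/2) ^ n)"
  shows "AE z in M. convergent (\<lambda>n. F n z)"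
proof -
  have "(\<integral>\<^sup>+ z. (\<Sum>n. ennreal \<bar>F n z - F (Suc n) z\<bar>) \<partial>M)
      = (\<Sum>n. \<integral>\<^sup>+ z. ennreal \<bar>F n z - F (Suc n) z\<bar> \<partial>M)"
    by (intro nn_integral_suminf) auto
  also have "\<dots> \<le> (\<Sum>n. ennreal ((1/2) ^ n))"
    by (intro suminf_le assms) auto
  also have "\<dots> < \<infinity>"
    using summable_geometric[of "1/2::real"] by (subst suminf_ennreal2) auto
  finally have "(\<integral>\<^sup>+ z. (\<Sum>n. ennreal \<bar>F n z - F (Suc n) z\<bar>) \<partial>M) \<noteq> \<infinity>" by simp
  then have "AE z in M. (\<Sum>n. ennreal \<bar>F n z - F (Suc n) z\<bar>) \<noteq> \<infinity>"
    by (intro nn_integral_PInf_AE) auto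
  then show ?thesis
  proof eventually_elim
    case (elim z)
    then have "summable (\<lambda>n. \<bar>F n z - F (Suc n) z\<bar>)"
      by (intro summable_suminf_not_top) auto
    then have "summable (\<lambda>n. F n z - F (Suc n) z)"
      by (rule summable_rabs_cancel)
    then have "convergent (\<lambda>n. \<Sum>i<n. F i z - F (Suc i) z)"
      by (simp add: summable_iff_convergent)
    then have "convergent (\<lambda>n. F 0 z - (\<Sum>i<n. F i z - F (Suc i) z))"
      by (intro convergent_diff convergent_const)
    moreover have "F 0 z - (\<Sum>i<n. F i z - F (Suc i) z) = F n z" for n
      by (induction n) (simp_all add: algebra_simps)
    ultimately show ?case by simp
  qed
qed

text \<open>A minimizing sequence chosen fast enough converges almost everywhere and in L1; its limit stays
  in \<open>K\<close> because \<open>K\<close> is closed in L1, and it is a minimizer by Fatou's lemma.\<close>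

theorem penalized_integral_minimizer_exists:
  fixes c :: "'a \<Rightarrow> real"
  assumes c [measurable]: "c \<in> borel_measurable M" and c0: "\<And>z. 0 \<le> c z" and k: "0 < k"
    and dens: "\<And>f. f \<in> K \<Longrightarrow> prob_density M f"
    and mid: "\<And>f g. f \<in> K \<Longrightarrow> g \<in> K \<Longrightarrow> (\<lambda>z. (f z + g z) / 2) \<in> K"
    and closed: "\<And>f. f \<in> borel_measurable M \<Longrightarrow> (\<And>z. 0 \<le> f z) \<Longrightarrow>
       (\<And>e. 0 < e \<Longrightarrow> \<exists>g\<in>K. (\<integral>\<^sup>+ z. ennreal \<bar>f z - g z\<bar> \<partial>M) \<le> ennreal e) \<Longrightarrow> f \<in> K"
    and fin: "f0 \<in> K" "penalized_integral k c M f0 < \<infinity>"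
  obtains f where "f \<in> K" "penalized_integral k c M f < \<infinity>"
    "\<And>g. g \<in> K \<Longrightarrow> penalized_integral k c M f \<le> penalized_integral k c M g"
proof -
  let ?G = "penalized_integral k c M"
  define m where "m = (INF f\<in>K. ?G f)"
  have m_le: "m \<le> ?G f" if "f \<in> K" for f
    unfolding m_def using that by (rule INF_lower)
  have m_fin: "m < \<infinity>" using m_le[OF fin(1)] fin(2) by simp

  \<comment> \<open>with \<open>l = (1/2) ^ n / 2\<close>, the bound \<open>4 * d n / (k * l) + l\<close> on the L1 distance is exactly \<open>(1/2) ^ n\<close>\<close>
  define d where "d n = k * (1/4) ^ n / 16" for n :: nat
  have d0: "0 < d n" for n using k by (simp add: d_def)
  have d_anti: "d n' \<le> d n" if "n \<le> n'" for n n'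
    using that k unfolding d_def by (simp add: power_decreasing)
  have "\<exists>f\<in>K. ?G f \<le> m + ennreal (d n)" for n
  proof -
    have "m < m + ennreal (d n)"
      using m_fin d0[of n] by (cases m) (auto simp flip: ennreal_plus simp: ennreal_lessI)
    then show ?thesis
      unfolding m_def INF_less_iff by (auto intro: less_imp_le)
  qed
  then obtain F where F: "\<And>n. F n \<in> K" and Fm: "\<And>n. ?G (F n) \<le> m + ennreal (d n)"
    by metis
  have [measurable]: "F n \<in> borel_measurable M" and F0: "0 \<le> F n z" for n z
    using dens[OF F] by (auto simp: prob_density_def)
  have cauchy: "(\<integral>\<^sup>+ z. ennreal \<bar>F n z - F n' z\<bar> \<partial>M) \<le> ennreal ((1/2) ^ n)" if "n \<le> n'" for n n'
  proof -
    have "(\<integral>\<^sup>+ z. ennreal \<bar>F n z - F n' z\<bar> \<partial>M)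
        \<le> ennreal (4 * d n / (k * ((1/2) ^ n / 2)) + (1/2) ^ n / 2)"
    proof (rule near_minimizers_L1_close[OF c c0 k dens[OF F] dens[OF F] m_le[OF mid[OF F F]] m_fin Fm])
      show "?G (F n') \<le> m + ennreal (d n)"
        using Fm[of n'] d_anti[OF that] by (meson add_left_mono ennreal_leI order_trans)
    qed (use d0[of n] in auto)
    also have "4 * d n / (k * ((1/2) ^ n / 2)) + (1/2) ^ n / 2 = (1/2) ^ n"
    proof -
      have "(1/4::real) ^ n = (1/2) ^ n * (1/2) ^ n" by (simp flip: power_mult_distrib)
      then show ?thesis using k by (simp add: d_def field_simps)
    qed
    finally show ?thesis .
  qed
  \<comment> \<open>\<open>lim\<close> is unspecified on the null set of divergence; \<open>max 0\<close> keeps \<open>f\<close> nonnegative there\<close>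
  define f where "f z = max 0 (lim (\<lambda>n. F n z))" for z
  have [measurable]: "f \<in> borel_measurable M" unfolding f_def by measurable
  have lim: "AE z in M. (\<lambda>n. F n z) \<longlonglongrightarrow> f z"
  proof -
    have "AE z in M. convergent (\<lambda>n. F n z)"
      by (rule AE_convergent_of_summable_L1) (auto intro: cauchy)
    then show ?thesis
    proof eventually_elim
      case (elim z)
      then have "(\<lambda>n. F n z) \<longlonglongrightarrow> lim (\<lambda>n. F n z)" by (simp add: convergent_LIMSEQ_iff)
      moreover from this have "0 \<le> lim (\<lambda>n. F n z)"
        by (rule LIMSEQ_le_const) (auto intro: F0)
      ultimately show ?case by (simp add: f_def max_def)
    qed
  qed
  have L1: "(\<integral>\<^sup>+ z. ennreal \<bar>f z - F n z\<bar> \<partial>M) \<le> ennreal ((1/2) ^ n)" for n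
  proof (rule nn_integral_lower_limit[where U = "\<lambda>n' z. \<bar>F n' z - F n z\<bar>" and N = n])
    show "AE z in M. (\<lambda>n'. \<bar>F n' z - F n z\<bar>) \<longlonglongrightarrow> \<bar>f z - F n z\<bar>"
      using lim by eventually_elim (intro tendsto_intros)
    show "(\<integral>\<^sup>+ z. ennreal \<bar>F n' z - F n z\<bar> \<partial>M) \<le> ennreal ((1/2) ^ n)" if "n \<le> n'" for n'
      using cauchy[OF that] by (simp add: abs_minus_commute)
  qed auto
  have fK: "f \<in> K"
  proof (rule closed)
    fix e :: real assume "0 < e"
    then obtain n where "(1/2) ^ n < e" using real_arch_pow_inv[of e "1/2"] by auto
    then show "\<exists>g\<in>K. (\<integral>\<^sup>+ z. ennreal \<bar>f z - g z\<bar> \<partial>M) \<le> ennreal e"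
      using F[of n] L1[of n] by (meson ennreal_leI less_imp_le order_trans)
  qed (auto simp: f_def)
  have "?G f \<le> m"
    unfolding penalized_integral_def
  proof (rule nn_integral_lower_limit[where U = "\<lambda>n z. c z * F n z + k * entropy_fun (F n z)"])
    show "AE z in M. (\<lambda>n. c z * F n z + k * entropy_fun (F n z))
            \<longlonglongrightarrow> c z * f z + k * entropy_fun (f z)"
      using lim by eventually_elim (intro tendsto_intros entropy_fun_tendsto F0)
    show "(\<integral>\<^sup>+ z. ennreal (c z * F n z + k * entropy_fun (F n z)) \<partial>M) \<le> m + ennreal (d n)" for n
      using Fm[of n] by (simp add: penalized_integral_def)
    have "d \<longlonglongrightarrow> 0" unfolding d_def by (auto intro!: tendsto_eq_intros LIMSEQ_power_zero)
    then have "(\<lambda>n. m + ennreal (d n)) \<longlonglongrightarrow> m + ennreal 0"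
      by (intro tendsto_add tendsto_const tendsto_ennrealI)
    then show "(\<lambda>n. m + ennreal (d n)) \<longlonglongrightarrow> m" by simp
  qed auto
  then show ?thesis
    using that[OF fK] m_fin m_le by (metis order_le_less_trans order_trans)
qed

lemma penalized_integral_minimizer_unique:
  fixes c :: "'a \<Rightarrow> real"
  assumes c: "c \<in> borel_measurable M" "\<And>z. 0 \<le> c z" and k: "0 < k"
    and f: "prob_density M f" and g: "prob_density M g"
    and mid: "m \<le> penalized_integral k c M (\<lambda>z. (f z + g z) / 2)" and fin: "m < \<infinity>"
    and "penalized_integral k c M f \<le> m" "penalized_integral k c M g \<le> m"
  shows "AE z in M. f z = g z"
proof -
  have [measurable]: "f \<in> borel_measurable M" "g \<in> borel_measurable M"
    using f g by (auto simp: prob_density_def)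
  have "(\<integral>\<^sup>+ z. ennreal \<bar>f z - g z\<bar> \<partial>M) \<le> 0 + ennreal l" if "0 < l" for l
    using near_minimizers_L1_close[OF c k f g mid fin, of 0 l] assms that by simp
  then have "(\<integral>\<^sup>+ z. ennreal \<bar>f z - g z\<bar> \<partial>M) \<le> 0"
    by (rule ennreal_le_epsilon)
  then have "(\<integral>\<^sup>+ z. ennreal \<bar>f z - g z\<bar> \<partial>M) = 0" by simp
  moreover have "(\<lambda>z. ennreal \<bar>f z - g z\<bar>) \<in> borel_measurable M" by measurable
  ultimately have "AE z in M. ennreal \<bar>f z - g z\<bar> = 0"
    by (simp only: nn_integral_0_iff_AE)
  then show ?thesis by eventually_elim simp
qed

section \<open>Entropic optimal transport\<close>

lemma absolutely_continuous_imp_prob_density: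
  assumes "prob_space r" "prob_space p" "sets p = sets r" "absolutely_continuous r p"
  obtains f where "prob_density r f" "p = density r (\<lambda>z. ennreal (f z))"
proof -
  interpret r: prob_space r by fact
  interpret p: prob_space p by fact
  obtain D where D: "D \<in> borel_measurable r" "AE z in r. RN_deriv r p z = ennreal (D z)"
      "\<And>z. 0 \<le> D z"
    using r.real_RN_deriv[OF p.finite_measure_axioms assms(4,3)] by metis
  note [measurable] = D(1)
  have "p = density r (RN_deriv r p)"
    using r.density_RN_deriv[OF assms(4,3)] by simp
  also have "\<dots> = density r (\<lambda>z. ennreal (D z))"
    using D by (intro density_cong) auto
  finally have p: "p = density r (\<lambda>z. ennreal (D z))" .
  have "(\<integral>\<^sup>+ z. ennreal (D z) \<partial>r) = emeasure p (space r)"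
    by (subst p) (simp add: emeasure_density)
  also have "\<dots> = 1"
    using p.emeasure_space_1 sets_eq_imp_space_eq[OF assms(3)] by simp
  finally show ?thesis using that[of D] D p by (simp add: prob_density_def)
qed

text \<open>Let \<open>U\<close> and \<open>N\<close> be the integrals of the positive and negative parts of \<open>f ln f\<close>, and \<open>\<Phi>\<close> that of
  \<open>entropy_fun \<circ> f\<close>. Integrating \<open>f ln f = entropy_fun f + f - 1\<close>, with both sides split into
  nonnegative terms, gives \<open>U + 1 = \<Phi> + N + 1\<close>. Moreover \<open>N \<le> 1\<close>, so the difference \<open>U - N\<close> is
  meaningful and equals \<open>\<Phi>\<close>.\<close>

lemma KL_density:
  assumes "prob_space r" and f: "prob_density r f"
  shows "KL (density r (\<lambda>z. ennreal (f z))) r = enn2ereal (\<integral>\<^sup>+ z. ennreal (entropy_fun (f z)) \<partial>r)"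
proof -
  interpret r: prob_space r by fact
  let ?p = "density r (\<lambda>z. ennreal (f z))"
  let ?e = "entropy_density (exp 1) r ?p"
  have [measurable]: "f \<in> borel_measurable r" and f0: "\<And>z. 0 \<le> f z"
    and f1: "(\<integral>\<^sup>+ z. ennreal (f z) \<partial>r) = 1"
    using f by (auto simp: prob_density_def)
  have ac: "absolutely_continuous r ?p"
    by (intro absolutely_continuousI_density) measurable
  have "AE z in r. ennreal (f z) = RN_deriv r ?p z"
    by (intro r.RN_deriv_unique) auto
  then have e: "AE z in r. ?e z = ln (f z)"
  proof eventually_elim
    case (elim z)
    then show ?case using f0 by (simp add: entropy_density_def log_def flip: elim)
  qed
  have [measurable]: "?e \<in> borel_measurable r"
    unfolding entropy_density_def by measurable
  define U where "U = (\<integral>\<^sup>+ z. ennreal (f z * ln (f z)) \<partial>r)"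
  define N where "N = (\<integral>\<^sup>+ z. ennreal (- (f z * ln (f z))) \<partial>r)"
  define \<Phi> where "\<Phi> = (\<integral>\<^sup>+ z. ennreal (entropy_fun (f z)) \<partial>r)"
  have pos: "(\<integral>\<^sup>+ z. ennreal (?e z) \<partial>?p) = U"
    unfolding U_def using e f0
    by (subst nn_integral_density) (auto intro!: nn_integral_cong_AE simp: ennreal_mult')
  have neg: "(\<integral>\<^sup>+ z. ennreal (- ?e z) \<partial>?p) = N"
    unfolding N_def using e f0
    by (subst nn_integral_density) (auto intro!: nn_integral_cong_AE simp flip: ennreal_mult')
  have "U + 1 = (\<integral>\<^sup>+ z. ennreal (f z * ln (f z)) + 1 \<partial>r)"
    by (simp add: nn_integral_add U_def r.emeasure_space_1)
  also have "\<dots> = (\<integral>\<^sup>+ z. (ennreal (entropy_fun (f z)) + ennreal (- (f z * ln (f z)))) + ennreal (f z) \<partial>r)"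
  proof (rule nn_integral_cong)
    fix z
    have "max 0 (f z * ln (f z)) + 1 = entropy_fun (f z) + max 0 (- (f z * ln (f z))) + f z"
      by (simp add: entropy_fun_def max_def)
    then have "ennreal (max 0 (f z * ln (f z)) + 1)
        = ennreal (entropy_fun (f z) + max 0 (- (f z * ln (f z))) + f z)" by simp
    then show "ennreal (f z * ln (f z)) + 1
        = (ennreal (entropy_fun (f z)) + ennreal (- (f z * ln (f z)))) + ennreal (f z)"
      using f0[of z] entropy_fun_nonneg[OF f0, of z] by (simp add: ennreal_plus ennreal_max_0)
  qed
  also have "\<dots> = (\<Phi> + N) + 1"
    by (simp add: nn_integral_add \<Phi>_def N_def f1)
  finally have "1 + U = 1 + (\<Phi> + N)" by (simp add: add.commute)
  then have U: "U = \<Phi> + N" by (simp add: ennreal_add_left_cancel)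
  have "N \<le> (\<integral>\<^sup>+ z. 1 \<partial>r)"
    unfolding N_def
  proof (intro nn_integral_mono)
    fix z
    show "ennreal (- (f z * ln (f z))) \<le> 1"
      using entropy_fun_nonneg[OF f0, of z] f0[of z] by (simp add: entropy_fun_def ennreal_le_1)
  qed
  then have N: "N \<noteq> \<infinity>" using r.emeasure_space_1 by (auto simp: top_unique)
  have "enn2ereal U - enn2ereal N = enn2ereal \<Phi>"
  proof -
    obtain n where "N = ennreal n" "0 \<le> n" using N by (cases N) auto
    then show ?thesis
      unfolding U by (cases \<Phi>) (auto simp: plus_ennreal.rep_eq simp flip: ennreal_plus)
  qed
  then show ?thesis
    unfolding KL_def pos neg \<Phi>_def using ac by simp
qed

definition transport_cost :: "'a::real_normed_vector \<times> 'a \<Rightarrow> real" where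
  "transport_cost z = (norm (fst z - snd z))\<^sup>2"

lemma transport_cost_measurable [measurable]:
  "transport_cost \<in> borel_measurable borel"
  unfolding transport_cost_def[abs_def]
  by (intro borel_measurable_continuous_onI continuous_intros)

lemma regularized_cost_density:
  assumes r: "prob_space r" and sets_r: "sets r = sets borel" and f: "prob_density r f"
    and \<epsilon>: "0 < \<epsilon>"
  shows "regularized_cost \<epsilon> r (density r (\<lambda>z. ennreal (f z)))
       = enn2ereal (penalized_integral (2 * \<epsilon>) transport_cost r f)"
proof -
  have [measurable]: "f \<in> borel_measurable r" and f0: "\<And>z. 0 \<le> f z"
    using f by (auto simp: prob_density_def)
  have [measurable]: "transport_cost \<in> borel_measurable r"
    using transport_cost_measurable by (simp add: measurable_cong_sets[OF sets_r refl])
  have c0: "0 \<le> transport_cost z" for z by (simp add: transport_cost_def)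
  have "(\<integral>\<^sup>+ (x, y). ennreal ((norm (x - y))\<^sup>2) \<partial>density r (\<lambda>z. ennreal (f z)))
      = (\<integral>\<^sup>+ z. ennreal (transport_cost z) \<partial>density r (\<lambda>z. ennreal (f z)))"
    by (simp add: transport_cost_def split_beta')
  also have "\<dots> = (\<integral>\<^sup>+ z. ennreal (transport_cost z * f z) \<partial>r)"
  proof (subst nn_integral_density)
    show "(\<integral>\<^sup>+ z. ennreal (f z) * ennreal (transport_cost z) \<partial>r)
        = (\<integral>\<^sup>+ z. ennreal (transport_cost z * f z) \<partial>r)"
      by (intro nn_integral_cong) (simp only: ennreal_mult f0 c0 mult.commute)
  qed auto
  finally have cost: "(\<integral>\<^sup>+ (x, y). ennreal ((norm (x - y))\<^sup>2) \<partial>density r (\<lambda>z. ennreal (f z)))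
      = (\<integral>\<^sup>+ z. ennreal (transport_cost z * f z) \<partial>r)" .
  have "penalized_integral (2 * \<epsilon>) transport_cost r f
      = (\<integral>\<^sup>+ z. ennreal (transport_cost z * f z) + ennreal (2 * \<epsilon>) * ennreal (entropy_fun (f z)) \<partial>r)"
    unfolding penalized_integral_def using \<epsilon>
    by (intro nn_integral_cong)
      (simp only: ennreal_plus ennreal_mult mult_nonneg_nonneg f0 c0 entropy_fun_nonneg
        less_imp_le zero_less_numeral mult_pos_pos)
  also have "\<dots> = (\<integral>\<^sup>+ z. ennreal (transport_cost z * f z) \<partial>r)
      + ennreal (2 * \<epsilon>) * (\<integral>\<^sup>+ z. ennreal (entropy_fun (f z)) \<partial>r)"
    by (simp add: nn_integral_add nn_integral_cmult)
  finally show ?thesis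
    unfolding regularized_cost_def cost KL_density[OF r f] using \<epsilon>
    by (simp add: plus_ennreal.rep_eq times_ennreal.rep_eq enn2ereal_ennreal)
qed

lemma regularized_cost_infinite:
  assumes "\<not> absolutely_continuous r p" "0 < \<epsilon>"
  shows "regularized_cost \<epsilon> r p = \<infinity>"
  using assms by (simp add: regularized_cost_def KL_def)

lemma distr_eq_iff:
  assumes X: "X \<in> p \<rightarrow>\<^sub>M \<mu>"
  shows "distr p \<mu> X = \<mu> \<longleftrightarrow> (\<forall>E\<in>sets \<mu>. emeasure p (X -` E \<inter> space p) = emeasure \<mu> E)"
proof
  assume eq: "distr p \<mu> X = \<mu>"
  show "\<forall>E\<in>sets \<mu>. emeasure p (X -` E \<inter> space p) = emeasure \<mu> E"
    using emeasure_distr[OF X] by (simp add: eq)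
next
  assume "\<forall>E\<in>sets \<mu>. emeasure p (X -` E \<inter> space p) = emeasure \<mu> E"
  then show "distr p \<mu> X = \<mu>"
    using X by (intro measure_eqI) (auto simp: emeasure_distr)
qed

lemma density_in_couplings_iff:
  assumes sets_r: "sets r = sets (\<mu> \<Otimes>\<^sub>M \<nu>)" and f: "prob_density r f"
  shows "density r (\<lambda>z. ennreal (f z)) \<in> couplings \<mu> \<nu> \<longleftrightarrow>
    (\<forall>E\<in>sets \<mu>. emeasure (density r (\<lambda>z. ennreal (f z))) (fst -` E \<inter> space r) = emeasure \<mu> E) \<and>
    (\<forall>E\<in>sets \<nu>. emeasure (density r (\<lambda>z. ennreal (f z))) (snd -` E \<inter> space r) = emeasure \<nu> E)"
proof -
  let ?p = "density r (\<lambda>z. ennreal (f z))"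
  have [measurable]: "f \<in> borel_measurable r" using f by (simp add: prob_density_def)
  have "fst \<in> ?p \<rightarrow>\<^sub>M \<mu>" "snd \<in> ?p \<rightarrow>\<^sub>M \<nu>"
    by (simp_all add: measurable_cong_sets[OF sets_r refl])
  moreover have "prob_space ?p"
    using f by (intro prob_spaceI) (simp add: emeasure_density prob_density_def)
  ultimately show ?thesis by (simp add: couplings_def sets_r distr_eq_iff)
qed

text \<open>Prescribed values on measurable sets, in particular prescribed marginals, survive L1 limits of
  densities: the measure of \<open>E\<close> changes by at most the L1 distance.\<close>

lemma emeasure_density_L1_limit:
  assumes [measurable]: "f \<in> borel_measurable M" "E \<in> sets M"
    and approx: "\<And>e. 0 < e \<Longrightarrow> \<exists>g\<in>K. (\<integral>\<^sup>+ z. ennreal \<bar>f z - g z\<bar> \<partial>M) \<le> ennreal e"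
    and K: "\<And>g. g \<in> K \<Longrightarrow> g \<in> borel_measurable M \<and> emeasure (density M (\<lambda>z. ennreal (g z))) E = a"
  shows "emeasure (density M (\<lambda>z. ennreal (f z))) E = a"
proof -
  have shift: "emeasure (density M (\<lambda>z. ennreal (u z))) E
      \<le> emeasure (density M (\<lambda>z. ennreal (v z))) E + (\<integral>\<^sup>+ z. ennreal \<bar>u z - v z\<bar> \<partial>M)"
    if [measurable]: "u \<in> borel_measurable M" "v \<in> borel_measurable M" for u v :: "'a \<Rightarrow> real"
  proof -
    have "emeasure (density M (\<lambda>z. ennreal (u z))) E = (\<integral>\<^sup>+ z. ennreal (u z) * indicator E z \<partial>M)"
      by (simp add: emeasure_density)
    also have "\<dots> \<le> (\<integral>\<^sup>+ z. ennreal (v z) * indicator E z + ennreal \<bar>u z - v z\<bar> \<partial>M)"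
    proof (rule nn_integral_mono)
      fix z
      have "ennreal (u z) \<le> ennreal (max 0 (v z) + \<bar>u z - v z\<bar>)"
        by (rule ennreal_leI) linarith
      then have "ennreal (u z) \<le> ennreal (v z) + ennreal \<bar>u z - v z\<bar>"
        by (simp add: ennreal_plus ennreal_max_0)
      then show "ennreal (u z) * indicator E z \<le> ennreal (v z) * indicator E z + ennreal \<bar>u z - v z\<bar>"
        by (simp split: split_indicator)
    qed
    also have "\<dots> = emeasure (density M (\<lambda>z. ennreal (v z))) E + (\<integral>\<^sup>+ z. ennreal \<bar>u z - v z\<bar> \<partial>M)"
      by (simp add: nn_integral_add emeasure_density)
    finally show ?thesis .
  qed
  let ?f = "emeasure (density M (\<lambda>z. ennreal (f z))) E"
  show ?thesis
  proof (rule antisym)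
    show "?f \<le> a"
    proof (rule ennreal_le_epsilon)
      fix e :: real assume "0 < e"
      then obtain g where g: "g \<in> K" "(\<integral>\<^sup>+ z. ennreal \<bar>f z - g z\<bar> \<partial>M) \<le> ennreal e"
        using approx by blast
      then have "?f \<le> a + (\<integral>\<^sup>+ z. ennreal \<bar>f z - g z\<bar> \<partial>M)"
        using shift[of f g] K[OF g(1)] by simp
      also have "\<dots> \<le> a + ennreal e" using g(2) by (intro add_left_mono)
      finally show "?f \<le> a + ennreal e" .
    qed
    show "a \<le> ?f"
    proof (rule ennreal_le_epsilon)
      fix e :: real assume "0 < e"
      then obtain g where g: "g \<in> K" "(\<integral>\<^sup>+ z. ennreal \<bar>f z - g z\<bar> \<partial>M) \<le> ennreal e"
        using approx by blast
      then have "a \<le> ?f + (\<integral>\<^sup>+ z. ennreal \<bar>g z - f z\<bar> \<partial>M)"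
        using shift[of g f] K[OF g(1)] by simp
      also have "\<dots> \<le> ?f + ennreal e" using g(2) by (intro add_left_mono) (simp add: abs_minus_commute)
      finally show "a \<le> ?f + ennreal e" .
    qed
  qed
qed

lemma emeasure_density_midpoint:
  assumes [measurable]: "f \<in> borel_measurable M" "g \<in> borel_measurable M" "E \<in> sets M"
    and nn: "\<And>z. 0 \<le> f z" "\<And>z. 0 \<le> g z"
    and a: "emeasure (density M (\<lambda>z. ennreal (f z))) E = a" "emeasure (density M (\<lambda>z. ennreal (g z))) E = a"
  shows "emeasure (density M (\<lambda>z. ennreal ((f z + g z) / 2))) E = a"
proof -
  have "emeasure (density M (\<lambda>z. ennreal ((f z + g z) / 2))) E
      = (\<integral>\<^sup>+ z. ennreal (1/2) * (ennreal (f z) * indicator E z + ennreal (g z) * indicator E z) \<partial>M)"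
    unfolding emeasure_density[OF _ \<open>E \<in> sets M\<close>]
  proof (subst emeasure_density)
    show "(\<integral>\<^sup>+ z. ennreal ((f z + g z) / 2) * indicator E z \<partial>M)
      = (\<integral>\<^sup>+ z. ennreal (1/2) * (ennreal (f z) * indicator E z + ennreal (g z) * indicator E z) \<partial>M)"
    proof (rule nn_integral_cong)
      fix z
      have "ennreal (1/2 * (f z + g z)) = ennreal (1/2) * (ennreal (f z) + ennreal (g z))"
        using nn by (simp only: ennreal_mult'' ennreal_plus add_nonneg_nonneg)
      then have "ennreal ((f z + g z) / 2) = ennreal (1/2) * (ennreal (f z) + ennreal (g z))"
        by (simp only: times_divide_eq_left mult_1_left)
      then show "ennreal ((f z + g z) / 2) * indicator E z
          = ennreal (1/2) * (ennreal (f z) * indicator E z + ennreal (g z) * indicator E z)"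
        by (simp split: split_indicator)
    qed
  qed auto
  also have "\<dots> = ennreal (1/2) * (a + a)"
    using a by (simp add: nn_integral_cmult nn_integral_add emeasure_density)
  also have "\<dots> = (ennreal (1/2) + ennreal (1/2)) * a"
    by (simp only: distrib_left distrib_right)
  also have "ennreal (1/2) + ennreal (1/2) = 1"
    using ennreal_plus[of "1/2" "1/2"] by simp
  also have "1 * a = a" by simp
  finally show ?thesis .
qed

text \<open>Couplings of finite cost are represented by their densities with respect to \<open>r\<close>. The densities
  of couplings form a convex set closed in L1, and on it the cost is the penalized integral. The finiteness assumption is
  essential: if all couplings had infinite cost, each of them would be a minimizer.\<close>

theorem entropic_transport_unique_minimizer:
  fixes \<mu> \<nu> :: "'a::{real_normed_vector, second_countable_topology} measure"
  assumes r: "prob_space r" "sets r = sets borel"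
    and \<mu>\<nu>: "sets \<mu> = sets borel" "sets \<nu> = sets borel"
    and \<epsilon>: "0 < \<epsilon>"
    and fin: "p0 \<in> couplings \<mu> \<nu>" "regularized_cost \<epsilon> r p0 < \<infinity>"
  shows "\<exists>!p. is_arg_min (regularized_cost \<epsilon> r) (\<lambda>p. p \<in> couplings \<mu> \<nu>) p"
proof -
  let ?C = "regularized_cost \<epsilon> r" and ?G = "penalized_integral (2 * \<epsilon>) transport_cost r"
  let ?d = "\<lambda>f. density r (\<lambda>z. ennreal (f z))"
  define K where "K = {f. prob_density r f \<and> ?d f \<in> couplings \<mu> \<nu>}"
  have sets_r: "sets r = sets (\<mu> \<Otimes>\<^sub>M \<nu>)"
    using r(2) sets_pair_measure_cong[OF \<mu>\<nu>] by (simp only: borel_prod)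
  have E1: "fst -` E \<inter> space r \<in> sets r" if "E \<in> sets \<mu>" for E
  proof -
    have "fst \<in> r \<rightarrow>\<^sub>M \<mu>" by (simp add: measurable_cong_sets[OF sets_r refl])
    then show ?thesis using that by (rule measurable_sets)
  qed
  have E2: "snd -` E \<inter> space r \<in> sets r" if "E \<in> sets \<nu>" for E
  proof -
    have "snd \<in> r \<rightarrow>\<^sub>M \<nu>" by (simp add: measurable_cong_sets[OF sets_r refl])
    then show ?thesis using that by (rule measurable_sets)
  qed
  have c: "transport_cost \<in> borel_measurable r" "\<And>z. 0 \<le> transport_cost z"
    using transport_cost_measurable
    by (simp_all add: measurable_cong_sets[OF r(2) refl] transport_cost_def)
  have k: "0 < 2 * \<epsilon>" using \<epsilon> by simp
  have repr: "\<exists>f\<in>K. p = ?d f" if "p \<in> couplings \<mu> \<nu>" "?C p < \<infinity>" for p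
  proof -
    have "absolutely_continuous r p"
      using that(2) regularized_cost_infinite[OF _ \<epsilon>, of r p] by auto
    moreover have "prob_space p" "sets p = sets r"
      using that(1) sets_r by (auto simp: couplings_def)
    ultimately obtain f where "prob_density r f" "p = ?d f"
      using absolutely_continuous_imp_prob_density[OF r(1)] by metis
    then show ?thesis using that(1) by (auto simp: K_def)
  qed
  have C_eq: "?C (?d f) = enn2ereal (?G f)" if "f \<in> K" for f
    using regularized_cost_density[OF r _ \<epsilon>] that by (simp add: K_def)
  have C_le: "?C (?d f) \<le> ?C (?d g) \<longleftrightarrow> ?G f \<le> ?G g" if "f \<in> K" "g \<in> K" for f g
    using that by (simp add: C_eq less_eq_ennreal.rep_eq)
  have C_fin: "?C (?d f) < \<infinity> \<longleftrightarrow> ?G f < \<infinity>" if "f \<in> K" for f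
    using that by (cases "?G f") (auto simp: C_eq)
  have K_dens: "prob_density r f" if "f \<in> K" for f
    using that by (simp add: K_def)
  have K_meas: "f \<in> borel_measurable r" "\<And>z. 0 \<le> f z" if "f \<in> K" for f
    using K_dens[OF that] by (auto simp: prob_density_def)
  have K_marg: "\<forall>E\<in>sets \<mu>. emeasure (?d f) (fst -` E \<inter> space r) = emeasure \<mu> E"
    "\<forall>E\<in>sets \<nu>. emeasure (?d f) (snd -` E \<inter> space r) = emeasure \<nu> E" if "f \<in> K" for f
    using that density_in_couplings_iff[OF sets_r K_dens[OF that]] by (auto simp: K_def)
  have K_total: "emeasure (?d f) (space r) = 1" if "f \<in> K" for f
  proof -
    note [measurable] = K_meas(1)[OF that]
    show ?thesis using K_dens[OF that] by (simp add: prob_density_def emeasure_density)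
  qed
  have K_I: "f \<in> K"
    if [measurable]: "f \<in> borel_measurable r" and "\<And>z. 0 \<le> f z" "emeasure (?d f) (space r) = 1"
      "\<And>E. E \<in> sets \<mu> \<Longrightarrow> emeasure (?d f) (fst -` E \<inter> space r) = emeasure \<mu> E"
      "\<And>E. E \<in> sets \<nu> \<Longrightarrow> emeasure (?d f) (snd -` E \<inter> space r) = emeasure \<nu> E" for f
  proof -
    have "prob_density r f" using that by (simp add: prob_density_def emeasure_density)
    then show ?thesis
      using that density_in_couplings_iff[OF sets_r] by (simp add: K_def)
  qed
  have mid: "(\<lambda>z. (f z + g z) / 2) \<in> K" if f: "f \<in> K" and g: "g \<in> K" for f g
  proof (rule K_I)
    note [measurable] = K_meas(1)[OF f] K_meas(1)[OF g]
    note half = emeasure_density_midpoint[OF K_meas(1)[OF f] K_meas(1)[OF g] _ K_meas(2)[OF f] K_meas(2)[OF g]]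
    show "(\<lambda>z. (f z + g z) / 2) \<in> borel_measurable r" by measurable
    show "0 \<le> (f z + g z) / 2" for z using K_meas(2)[OF f, of z] K_meas(2)[OF g, of z] by simp
    show "emeasure (?d (\<lambda>z. (f z + g z) / 2)) (space r) = 1"
      by (rule half) (auto simp: K_total f g)
    show "emeasure (?d (\<lambda>z. (f z + g z) / 2)) (fst -` E \<inter> space r) = emeasure \<mu> E"
      if "E \<in> sets \<mu>" for E
      using that K_marg(1)[OF f] K_marg(1)[OF g] by (intro half E1) auto
    show "emeasure (?d (\<lambda>z. (f z + g z) / 2)) (snd -` E \<inter> space r) = emeasure \<nu> E"
      if "E \<in> sets \<nu>" for E
      using that K_marg(2)[OF f] K_marg(2)[OF g] by (intro half E2) auto
  qed
  have closed: "f \<in> K"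
    if f: "f \<in> borel_measurable r" "\<And>z. 0 \<le> f z"
      and approx: "\<And>e. 0 < e \<Longrightarrow> \<exists>g\<in>K. (\<integral>\<^sup>+ z. ennreal \<bar>f z - g z\<bar> \<partial>r) \<le> ennreal e" for f
  proof (rule K_I[OF f])
    note lim = emeasure_density_L1_limit[OF f(1) _ approx]
    show "emeasure (?d f) (space r) = 1"
      by (rule lim) (auto simp: K_meas K_total)
    show "emeasure (?d f) (fst -` E \<inter> space r) = emeasure \<mu> E" if "E \<in> sets \<mu>" for E
      using that K_marg(1) by (intro lim E1) (auto simp: K_meas)
    show "emeasure (?d f) (snd -` E \<inter> space r) = emeasure \<nu> E" if "E \<in> sets \<nu>" for E
      using that K_marg(2) by (intro lim E2) (auto simp: K_meas)
  qed
  obtain f0 where f0: "f0 \<in> K" "?G f0 < \<infinity>"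
    using repr[OF fin] fin(2) C_fin by auto
  have "\<exists>f\<in>K. ?G f < \<infinity> \<and> (\<forall>g\<in>K. ?G f \<le> ?G g)"
  proof (rule penalized_integral_minimizer_exists[OF c k _ _ _ f0])
    show "prob_density r f" if "f \<in> K" for f using that by (rule K_dens)
    show "(\<lambda>z. (f z + g z) / 2) \<in> K" if "f \<in> K" "g \<in> K" for f g using that by (rule mid)
    show "f \<in> K" if "f \<in> borel_measurable r" "\<And>z. 0 \<le> f z"
      "\<And>e. 0 < e \<Longrightarrow> \<exists>g\<in>K. (\<integral>\<^sup>+ z. ennreal \<bar>f z - g z\<bar> \<partial>r) \<le> ennreal e" for f
      using that by (rule closed)
  qed blast
  then obtain f where f: "f \<in> K" "?G f < \<infinity>" and min: "\<And>g. g \<in> K \<Longrightarrow> ?G f \<le> ?G g"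
    by blast
  have f_coupling: "?d f \<in> couplings \<mu> \<nu>" using f(1) by (simp add: K_def)
  show ?thesis
  proof (rule ex1I[of _ "?d f"])
    have "\<not> ?C q < ?C (?d f)" if q: "q \<in> couplings \<mu> \<nu>" for q
    proof
      assume less: "?C q < ?C (?d f)"
      then have "?C q < \<infinity>" by (rule less_le_trans) simp
      then obtain g where "g \<in> K" "q = ?d g" using repr[OF q] by blast
      then show False using min C_le[OF f(1)] less by (metis not_le)
    qed
    then show "is_arg_min ?C (\<lambda>p. p \<in> couplings \<mu> \<nu>) (?d f)"
      using f_coupling by (auto simp: is_arg_min_def)
  next
    fix q assume q: "is_arg_min ?C (\<lambda>p. p \<in> couplings \<mu> \<nu>) q"
    then have le: "?C q \<le> ?C (?d f)"
      using f_coupling by (auto simp: is_arg_min_def not_less)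
    also have "\<dots> < \<infinity>" using f C_fin by simp
    finally obtain g where g: "g \<in> K" "q = ?d g" using repr q by (auto simp: is_arg_min_def)
    then have "?G g \<le> ?G f" using le C_le f(1) by simp
    then have "AE z in r. f z = g z"
      using penalized_integral_minimizer_unique[OF c k K_dens[OF f(1)] K_dens[OF g(1)]
          min[OF mid[OF f(1) g(1)]] f(2)] by simp
    then have "?d f = ?d g"
      using K_meas(1)[OF f(1)] K_meas(1)[OF g(1)] by (intro density_cong) auto
    then show "q = ?d f" using g by simp
  qed
qed

section \<open>Linear change of variables for Lebesgue measure\<close>

lemma linear_borel_measurable:
  "linear f \<Longrightarrow> (f :: 'a::euclidean_space \<Rightarrow> 'b::euclidean_space) \<in> borel_measurable borel"
  by (intro borel_measurable_continuous_onI linear_continuous_on)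
     (simp add: linear_conv_bounded_linear)

text \<open>A linear map that permutes coordinates pulls boxes back to boxes of the same volume. Besides
  coordinate transpositions this covers the identification of \<open>real^('d + 'd)\<close> with a product.\<close>

lemma distr_lborel_basis_bij:
  fixes T :: "'a::euclidean_space \<Rightarrow> 'b::euclidean_space"
  assumes T: "linear T" and bij: "bij_betw T Basis Basis"
  shows "distr lborel borel T = lborel"
proof (rule lborel_eqI[symmetric])
  have [measurable]: "T \<in> borel_measurable borel"
    using T by (rule linear_borel_measurable)
  have inner_T: "T x \<bullet> T b = x \<bullet> b" if b: "b \<in> Basis" for x b
  proof -
    have "T x = T (\<Sum>c\<in>Basis. (x \<bullet> c) *\<^sub>R c)" by (simp add: euclidean_representation)
    also have "\<dots> = (\<Sum>c\<in>Basis. (x \<bullet> c) *\<^sub>R T c)"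
      by (simp add: linear_sum[OF T] linear_scale[OF T])
    finally have "T x \<bullet> T b = (\<Sum>c\<in>Basis. (x \<bullet> c) * (T c \<bullet> T b))"
      by (simp add: inner_sum_left)
    also have "\<dots> = (\<Sum>c\<in>Basis. if c = b then x \<bullet> c else 0)"
    proof (intro sum.cong refl)
      fix c :: 'a assume c: "c \<in> Basis"
      have "T c \<in> Basis" "T b \<in> Basis" "T c = T b \<longleftrightarrow> c = b"
        using b c bij by (auto simp: bij_betw_def inj_on_def)
      then show "(x \<bullet> c) * (T c \<bullet> T b) = (if c = b then x \<bullet> c else 0)"
        by (simp add: inner_Basis)
    qed
    also have "\<dots> = x \<bullet> b" using b by simp
    finally show ?thesis .
  qed
  fix l u :: 'b assume le: "\<And>b. b \<in> Basis \<Longrightarrow> l \<bullet> b \<le> u \<bullet> b"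
  define pull where "pull v = (\<Sum>b\<in>Basis. (v \<bullet> T b) *\<^sub>R b)" for v :: 'b
  have pull: "pull v \<bullet> b = v \<bullet> T b" if "b \<in> Basis" for v b
    using that by (simp add: pull_def)
  have img: "Basis = T ` Basis" using bij by (simp add: bij_betw_def)
  have "T -` box l u = box (pull l) (pull u)"
    unfolding box_def by (subst img) (auto simp: inner_T pull)
  then have "emeasure (distr lborel borel T) (box l u) = emeasure lborel (box (pull l) (pull u))"
    by (simp add: emeasure_distr)
  also have "\<dots> = (\<Prod>b\<in>Basis. (pull u - pull l) \<bullet> b)"
    using le img by (intro emeasure_lborel_box) (auto simp: pull)
  also have "\<dots> = (\<Prod>b\<in>Basis. (u - l) \<bullet> T b)"
    by (intro arg_cong[where f = ennreal] prod.cong) (auto simp: pull inner_diff_left)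
  also have "\<dots> = (\<Prod>b\<in>Basis. (u - l) \<bullet> b)"
    using prod.reindex_bij_betw[OF bij, of "\<lambda>b. (u - l) \<bullet> b"] by simp
  finally show "emeasure (distr lborel borel T) (box l u) = (\<Prod>b\<in>Basis. (u - l) \<bullet> b)" .
qed simp

lemma nn_integral_lborel_translate:
  fixes h :: "'a::euclidean_space \<Rightarrow> ennreal"
  assumes [measurable]: "h \<in> borel_measurable borel"
  shows "(\<integral>\<^sup>+ x. h (a + x) \<partial>lborel) = (\<integral>\<^sup>+ x. h x \<partial>lborel)"
proof -
  have "(\<integral>\<^sup>+ x. h x \<partial>lborel) = (\<integral>\<^sup>+ x. h x \<partial>distr lborel borel ((+) a))"
    by (simp add: lborel_distr_plus)
  then show ?thesis by (simp add: nn_integral_distr)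
qed

text \<open>The reason is translation invariance. Weighting by the indicator \<open>\<rho>\<close> of a unit interval in
  direction \<open>e\<close>, Fubini and a translation of \<open>x\<close> by \<open>- s e\<close> replace the integral of \<open>h\<close> by integrals over full lines parallel to \<open>e\<close>; on each line
  the shear is only a shift. The resulting expression does not mention \<open>w\<close>, so it is the same as
  for \<open>w = 0\<close>.\<close>

lemma nn_integral_lborel_shear:
  fixes h :: "'a::euclidean_space \<Rightarrow> ennreal" and e w :: 'a
  assumes h [measurable]: "h \<in> borel_measurable borel" and e: "e \<bullet> e = 1" and w: "w \<bullet> e = 0"
  shows "(\<integral>\<^sup>+ x. h (x + (w \<bullet> x) *\<^sub>R e) \<partial>lborel) = (\<integral>\<^sup>+ x. h x \<partial>lborel)"
proof -
  define \<rho> :: "real \<Rightarrow> ennreal" where "\<rho> = indicator {0..1}"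
  have [measurable]: "\<rho> \<in> borel_measurable borel" unfolding \<rho>_def by measurable
  have \<rho>1: "(\<integral>\<^sup>+ s. \<rho> (a + s) \<partial>lborel) = 1" for a :: real
    by (subst nn_integral_lborel_translate) (auto simp: \<rho>_def)
  have swept: "(\<integral>\<^sup>+ x. h (x + (v \<bullet> x) *\<^sub>R e) \<partial>lborel)
      = (\<integral>\<^sup>+ x. \<rho> (x \<bullet> e) * (\<integral>\<^sup>+ s. h (x + s *\<^sub>R e) \<partial>lborel) \<partial>lborel)"
    if v: "v \<bullet> e = 0" for v
  proof -
    have "(\<integral>\<^sup>+ x. h (x + (v \<bullet> x) *\<^sub>R e) \<partial>lborel)
        = (\<integral>\<^sup>+ x. (\<integral>\<^sup>+ s. h (x + (v \<bullet> x) *\<^sub>R e) * \<rho> (x \<bullet> e + s) \<partial>lborel) \<partial>lborel)"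
      by (simp add: nn_integral_cmult \<rho>1)
    also have "\<dots> = (\<integral>\<^sup>+ s. (\<integral>\<^sup>+ x. h (x + (v \<bullet> x) *\<^sub>R e) * \<rho> (x \<bullet> e + s) \<partial>lborel) \<partial>lborel)"
      by (rule lborel_pair.Fubini'[symmetric]) (simp add: split_beta')
    also have "\<dots> = (\<integral>\<^sup>+ s. (\<integral>\<^sup>+ x. h (x + (v \<bullet> x - s) *\<^sub>R e) * \<rho> (x \<bullet> e) \<partial>lborel) \<partial>lborel)"
    proof (rule nn_integral_cong)
      fix s :: real
      have "h (- s *\<^sub>R e + x + (v \<bullet> (- s *\<^sub>R e + x)) *\<^sub>R e) * \<rho> ((- s *\<^sub>R e + x) \<bullet> e + s)
          = h (x + (v \<bullet> x - s) *\<^sub>R e) * \<rho> (x \<bullet> e)" for x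
        by (simp add: inner_add_left inner_add_right inner_diff_left inner_diff_right v e
              scaleR_diff_left add.commute add_diff_eq diff_add_eq)
      then show "(\<integral>\<^sup>+ x. h (x + (v \<bullet> x) *\<^sub>R e) * \<rho> (x \<bullet> e + s) \<partial>lborel)
          = (\<integral>\<^sup>+ x. h (x + (v \<bullet> x - s) *\<^sub>R e) * \<rho> (x \<bullet> e) \<partial>lborel)"
        using nn_integral_lborel_translate[of "\<lambda>x. h (x + (v \<bullet> x) *\<^sub>R e) * \<rho> (x \<bullet> e + s)" "- s *\<^sub>R e"]
        by simp
    qed
    also have "\<dots> = (\<integral>\<^sup>+ x. (\<integral>\<^sup>+ s. h (x + (v \<bullet> x - s) *\<^sub>R e) * \<rho> (x \<bullet> e) \<partial>lborel) \<partial>lborel)"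
      by (rule lborel_pair.Fubini') (simp add: split_beta')
    also have "\<dots> = (\<integral>\<^sup>+ x. \<rho> (x \<bullet> e) * (\<integral>\<^sup>+ s. h (x + s *\<^sub>R e) \<partial>lborel) \<partial>lborel)"
    proof (rule nn_integral_cong)
      fix x :: 'a
      have "(\<integral>\<^sup>+ s. h (x + s *\<^sub>R e) \<partial>lborel) = (\<integral>\<^sup>+ s. h (x + (v \<bullet> x - s) *\<^sub>R e) \<partial>lborel)"
        using nn_integral_real_affine[of "\<lambda>s. h (x + s *\<^sub>R e)" "-1" "v \<bullet> x"] by simp
      then show "(\<integral>\<^sup>+ s. h (x + (v \<bullet> x - s) *\<^sub>R e) * \<rho> (x \<bullet> e) \<partial>lborel)
          = \<rho> (x \<bullet> e) * (\<integral>\<^sup>+ s. h (x + s *\<^sub>R e) \<partial>lborel)"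
        by (simp add: nn_integral_multc) (simp add: mult.commute)
    qed
    finally show ?thesis .
  qed
  show ?thesis using swept[OF w] swept[of 0] by simp
qed

lemma Basis_vec_axis: "(Basis :: (real^'n) set) = range (\<lambda>i. axis i 1)"
  by (auto simp: Basis_vec_def)

text \<open>Linear change of variables for an arbitrary finite index type. By elimination a linear map is a
  product of diagonal maps, transpositions, elementary shears and maps with a vanishing coordinate.
  The claim is multiplicative, and vacuous for singular factors.\<close>

theorem nn_integral_lborel_linear:
  fixes f :: "real^'n \<Rightarrow> real^'n" and h :: "real^'n \<Rightarrow> ennreal"
  assumes "linear f" and "det (matrix f) \<noteq> 0" and "h \<in> borel_measurable borel"
  shows "(\<integral>\<^sup>+ x. h x \<partial>lborel) = ennreal \<bar>det (matrix f)\<bar> * (\<integral>\<^sup>+ x. h (f x) \<partial>lborel)"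
proof -
  let ?P = "\<lambda>f :: real^'n \<Rightarrow> real^'n. det (matrix f) \<noteq> 0 \<longrightarrow> (\<forall>h \<in> borel_measurable borel.
      (\<integral>\<^sup>+ x. h x \<partial>lborel) = ennreal \<bar>det (matrix f)\<bar> * (\<integral>\<^sup>+ x. h (f x) \<partial>lborel))"
  have "?P f"
  proof (rule induct_linear_elementary[OF \<open>linear f\<close>])
    fix f g :: "real^'n \<Rightarrow> real^'n"
    assume lin: "linear f" "linear g" and f: "?P f" and g: "?P g"
    have [measurable]: "f \<in> borel_measurable borel" using lin(1) by (rule linear_borel_measurable)
    have det: "det (matrix (f \<circ> g)) = det (matrix f) * det (matrix g)"
      by (simp add: matrix_compose[OF lin(2,1)] det_mul)
    show "?P (f \<circ> g)"
    proof (intro impI ballI)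
      fix h :: "real^'n \<Rightarrow> ennreal" assume [measurable]: "h \<in> borel_measurable borel"
      assume "det (matrix (f \<circ> g)) \<noteq> 0"
      then have "det (matrix f) \<noteq> 0" "det (matrix g) \<noteq> 0" by (auto simp: det)
      moreover have "(\<lambda>x. h (f x)) \<in> borel_measurable borel" by measurable
      ultimately show "(\<integral>\<^sup>+ x. h x \<partial>lborel)
          = ennreal \<bar>det (matrix (f \<circ> g))\<bar> * (\<integral>\<^sup>+ x. h ((f \<circ> g) x) \<partial>lborel)"
        using f g \<open>h \<in> _\<close> by (simp add: det abs_mult ennreal_mult mult.assoc)
    qed
  next
    fix f :: "real^'n \<Rightarrow> real^'n" and i
    assume "linear f" "\<And>x. f x $ i = 0"
    then have "row i (matrix f) = 0" by (simp add: row_def matrix_def vec_eq_iff)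
    then show "?P f" using det_zero_row(1) by blast
  next
    fix c :: "'n \<Rightarrow> real"
    let ?f = "\<lambda>x :: real^'n. \<chi> i. c i * x $ i"
    let ?c = "\<lambda>b :: real^'n. ?f b \<bullet> b"
    have det: "det (matrix ?f) = (\<Prod>i\<in>UNIV. c i)"
      by (subst det_diagonal) (auto simp: matrix_def axis_def)
    have inj: "inj (\<lambda>i :: 'n. axis i (1 :: real))" by (auto simp: inj_on_def axis_eq_axis)
    have c_axis: "?c (axis i 1) = c i" for i
      by (simp only: inner_axis) (simp add: axis_def)
    have f_eq: "?f x = 0 + (\<Sum>j\<in>Basis. (?c j * (x \<bullet> j)) *\<^sub>R j)" for x
    proof -
      have "(\<Sum>j\<in>Basis. (?c j * (x \<bullet> j)) *\<^sub>R j) = (\<Sum>i\<in>UNIV. (c i * x $ i) *\<^sub>R axis i 1)"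
        unfolding Basis_vec_axis sum.reindex[OF inj] o_def c_axis by (simp add: inner_axis)
      also have "\<dots> = ?f x"
        by (simp add: vec_eq_iff axis_def if_distrib[where f = "\<lambda>y. _ * y"] cong: if_cong)
      finally show ?thesis by simp
    qed
    have f_fun: "?f = (\<lambda>x. 0 + (\<Sum>j\<in>Basis. (?c j * (x \<bullet> j)) *\<^sub>R j))"
      by (rule ext) (rule f_eq)
    have prod_eq: "(\<Prod>j\<in>Basis. \<bar>?c j\<bar>) = \<bar>\<Prod>i\<in>UNIV. c i\<bar>"
      unfolding Basis_vec_axis by (subst prod.reindex[OF inj]) (simp add: c_axis abs_prod)
    show "?P ?f"
    proof (intro impI ballI)
      fix h :: "real^'n \<Rightarrow> ennreal" assume [measurable]: "h \<in> borel_measurable borel"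
      assume "det (matrix ?f) \<noteq> 0"
      then have "c i \<noteq> 0" for i by (auto simp: det)
      then have "?c j \<noteq> 0" if "j \<in> Basis" for j
        using that c_axis by (auto simp: Basis_vec_axis)
      then have eq: "lborel = density (distr lborel borel ?f) (\<lambda>_. ennreal \<bar>\<Prod>i\<in>UNIV. c i\<bar>)"
        unfolding f_fun prod_eq[symmetric] by (intro lborel_affine_euclidean) auto
      have [measurable]: "?f \<in> borel_measurable borel"
        by (intro linear_borel_measurable linearI) (auto simp: vec_eq_iff algebra_simps)
      show "(\<integral>\<^sup>+ x. h x \<partial>lborel) = ennreal \<bar>det (matrix ?f)\<bar> * (\<integral>\<^sup>+ x. h (?f x) \<partial>lborel)"
        unfolding det by (subst eq) (simp add: nn_integral_density nn_integral_distr nn_integral_cmult)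
    qed
  next
    fix m n :: 'n
    let ?t = "Transposition.transpose m n"
    let ?f = "\<lambda>x :: real^'n. \<chi> i. x $ ?t i"
    have lin: "linear ?f" by (rule linearI) (auto simp: vec_eq_iff)
    have [measurable]: "?f \<in> borel_measurable borel" by (rule linear_borel_measurable[OF lin])
    have "matrix ?f = (\<chi> i. mat 1 $ ?t i)"
      by (simp add: matrix_def mat_def axis_def vec_eq_iff)
    then have det: "\<bar>det (matrix ?f)\<bar> = 1"
      by (simp add: det_permute_rows permutes_swap_id sign_swap_id)
    have f_axis: "?f (axis i 1) = axis (?t i) 1" for i
      by (auto simp: axis_def vec_eq_iff)
    have "distr lborel borel ?f = lborel"
    proof (rule distr_lborel_basis_bij[OF lin])
      show "bij_betw ?f Basis Basis"
      proof (rule bij_betwI[where g = ?f])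
        show "?f \<in> Basis \<rightarrow> Basis" "?f \<in> Basis \<rightarrow> Basis"
          by (auto simp only: Basis_vec_axis f_axis)
      qed (simp_all add: vec_eq_iff)
    qed
    then have inv: "(\<integral>\<^sup>+ x. h x \<partial>lborel) = (\<integral>\<^sup>+ x. h (?f x) \<partial>lborel)"
      if [measurable]: "h \<in> borel_measurable borel" for h
      using nn_integral_distr[of ?f lborel borel h] by simp
    show "?P ?f"
    proof (intro impI ballI)
      fix h :: "real^'n \<Rightarrow> ennreal" assume h: "h \<in> borel_measurable borel"
      show "(\<integral>\<^sup>+ x. h x \<partial>lborel) = ennreal \<bar>det (matrix ?f)\<bar> * (\<integral>\<^sup>+ x. h (?f x) \<partial>lborel)"
        unfolding det using inv[OF h] by simp
    qed
  next
    fix m n :: 'n assume mn: "m \<noteq> n"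
    let ?f = "\<lambda>x :: real^'n. \<chi> i. if i = m then x $ m + x $ n else x $ i"
    have "matrix ?f = (\<chi> k. if k = m then row m (mat 1) + 1 *s row n (mat 1) else row k (mat 1))"
      by (simp add: matrix_def mat_def axis_def vec_eq_iff row_def)
    then have det: "det (matrix ?f) = 1"
      using det_row_operation[OF mn, where c = 1 and A = "mat 1 :: real^'n^'n"] by (simp only: det_I)
    have f_eq: "?f x = x + (axis n 1 \<bullet> x) *\<^sub>R axis m 1" for x
      by (simp only: inner_axis') (simp add: vec_eq_iff axis_def)
    show "?P ?f"
    proof (intro impI ballI)
      fix h :: "real^'n \<Rightarrow> ennreal" assume h: "h \<in> borel_measurable borel"
      have "(\<integral>\<^sup>+ x. h (?f x) \<partial>lborel) = (\<integral>\<^sup>+ x. h x \<partial>lborel)"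
        unfolding f_eq using mn
        by (intro nn_integral_lborel_shear[OF h]) (simp_all add: inner_axis_axis)
      then show "(\<integral>\<^sup>+ x. h x \<partial>lborel) = ennreal \<bar>det (matrix ?f)\<bar> * (\<integral>\<^sup>+ x. h (?f x) \<partial>lborel)"
        unfolding det by simp
    qed
  qed
  then show ?thesis using assms by blast
qed

section \<open>Centered Gaussian measures\<close>

text \<open>Gram--Schmidt for the inner product \<open>x \<bullet> (P *v y)\<close>: while fewer than \<open>CARD('n)\<close> vectors
  \<open>v i\<close> are found, some nonzero \<open>x\<close> is orthogonal to all \<open>P *v v i\<close>. The columns of \<open>V\<close> are the
  resulting \<open>P\<close>-orthonormal basis.\<close>

lemma sym_pos_def_conjugate_identity:
  fixes P :: "real^'n^'n"
  assumes "sym_pos_def P"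
  obtains V :: "real^'n^'n" where "transpose V ** P ** V = mat 1"
proof -
  have sym: "x \<bullet> (P *v y) = y \<bullet> (P *v x)" for x y
    using assms unfolding sym_pos_def_def
    by (metis dot_lmul_matrix inner_commute vector_transpose_matrix)
  have pos: "0 < x \<bullet> (P *v x)" if "x \<noteq> 0" for x
    using assms that by (simp add: sym_pos_def_def)
  have "\<exists>v :: 'n \<Rightarrow> real^'n. \<forall>i\<in>I. \<forall>j\<in>I. v i \<bullet> (P *v v j) = (if i = j then 1 else 0)"
    if "finite I" for I
    using that
  proof (induction I rule: finite_induct)
    case (insert k I)
    then obtain v :: "'n \<Rightarrow> real^'n"
      where v: "\<And>i j. i \<in> I \<Longrightarrow> j \<in> I \<Longrightarrow> v i \<bullet> (P *v v j) = (if i = j then 1 else 0)"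
      by blast
    let ?S = "(\<lambda>i. P *v v i) ` I"
    have "dim ?S \<le> card ?S" using insert.hyps by (intro dim_le_card') auto
    also have "card ?S \<le> card I" using insert.hyps by (intro card_image_le)
    also have "card I < card (UNIV :: 'n set)"
      using insert.hyps by (intro psubset_card_mono) auto
    finally have "dim ?S < DIM(real^'n)" by simp
    then obtain x where "x \<noteq> 0" and orth: "\<And>y. y \<in> span ?S \<Longrightarrow> orthogonal x y"
      by (rule orthogonal_to_subspace_exists) blast
    define u where "u = (1 / sqrt (x \<bullet> (P *v x))) *\<^sub>R x"
    have "u \<bullet> (P *v u) = 1"
      using pos[OF \<open>x \<noteq> 0\<close>] by (simp add: u_def matrix_vector_mult_scaleR)
    moreover have "u \<bullet> (P *v v i) = 0" if "i \<in> I" for i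
      using orth[OF span_base, of "P *v v i"] that by (simp add: u_def orthogonal_def)
    moreover from this have "v i \<bullet> (P *v u) = 0" if "i \<in> I" for i
      using that by (simp add: sym)
    ultimately have "\<forall>i\<in>insert k I. \<forall>j\<in>insert k I.
        (v(k := u)) i \<bullet> (P *v (v(k := u)) j) = (if i = j then 1 else 0)"
      using v insert.hyps by auto
    then show ?case by blast
  qed simp
  from this[of UNIV] obtain v :: "'n \<Rightarrow> real^'n"
    where v: "\<And>i j. v i \<bullet> (P *v v j) = (if i = j then 1 else 0)" by auto
  define V :: "real^'n^'n" where "V = (\<chi> i j. v j $ i)"
  have col: "(P ** V) $ k $ j = (P *v v j) $ k" for k j
    by (simp add: V_def matrix_matrix_mult_def matrix_vector_mult_def)
  have "(transpose V ** (P ** V)) $ i $ j = v i \<bullet> (P *v v j)" for i j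
    unfolding matrix_matrix_mult_def[of "transpose V"]
    by (simp add: col inner_vec_def) (simp add: V_def transpose_def)
  then have "transpose V ** P ** V = mat 1"
    by (simp add: vec_eq_iff mat_def v matrix_mul_assoc)
  then show ?thesis by (rule that)
qed

lemma sym_pos_def_det_pos:
  fixes P :: "real^'n^'n"
  assumes "sym_pos_def P"
  shows "0 < det P"
proof -
  obtain V :: "real^'n^'n" where "transpose V ** P ** V = mat 1"
    using sym_pos_def_conjugate_identity[OF assms] by blast
  then have "det (transpose V ** P ** V) = 1" by simp
  then have "(det V)\<^sup>2 * det P = 1" by (simp add: det_mul power2_eq_square mult_ac)
  then show ?thesis
    by (metis not_one_le_zero linorder_not_less mult_nonneg_nonpos zero_le_power2)
qed

lemma sym_pos_def_inverse:
  fixes A :: "real^'n^'n"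
  assumes A: "sym_pos_def A"
  shows "sym_pos_def (matrix_inv A)" and "det (matrix_inv A) = 1 / det A"
proof -
  have "invertible A" using sym_pos_def_det_pos[OF A] by (simp add: invertible_det_nz)
  then have inv: "A ** matrix_inv A = mat 1" 
    unfolding invertible_def matrix_inv_def by (rule someI2_ex) simp
  then have "det A * det (matrix_inv A) = 1" by (metis det_mul det_I)
  then show "det (matrix_inv A) = 1 / det A"
    using sym_pos_def_det_pos[OF A] by (simp add: field_simps)
  have "transpose (matrix_inv A) = transpose (matrix_inv A) ** (A ** matrix_inv A)"
    by (simp add: inv)
  also have "\<dots> = transpose (A ** matrix_inv A) ** matrix_inv A"
    using A by (simp add: matrix_transpose_mul matrix_mul_assoc sym_pos_def_def)
  finally have sym: "transpose (matrix_inv A) = matrix_inv A" by (simp add: inv transpose_mat)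
  have "0 < x \<bullet> (matrix_inv A *v x)" if "x \<noteq> 0" for x
  proof -
    define y where "y = matrix_inv A *v x"
    have x: "x = A *v y" by (simp add: y_def matrix_vector_mul_assoc inv)
    then have "y \<noteq> 0" using that by auto
    then have "0 < y \<bullet> (A *v y)" using A by (simp add: sym_pos_def_def)
    then show ?thesis by (simp add: x[symmetric] y_def[symmetric] inner_commute)
  qed
  with sym show "sym_pos_def (matrix_inv A)" by (simp add: sym_pos_def_def)
qed

text \<open>If the quadratic form vanished at \<open>x \<noteq> 0\<close>, it would be negative at \<open>x - r A x\<close> for small
  \<open>r > 0\<close>, since \<open>A x \<noteq> 0\<close>.\<close>

lemma covariance_matrix_invertible_imp_sym_pos_def:
  fixes A :: "real^'n^'n"
  assumes "covariance_matrix A" "invertible A"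
  shows "sym_pos_def A"
proof -
  have sym: "x \<bullet> (A *v y) = y \<bullet> (A *v x)" for x y
    using assms(1) unfolding covariance_matrix_def
    by (metis dot_lmul_matrix inner_commute vector_transpose_matrix)
  have nonneg: "0 \<le> x \<bullet> (A *v x)" for x using assms(1) by (simp add: covariance_matrix_def)
  have "x \<bullet> (A *v x) \<noteq> 0" if "x \<noteq> 0" for x
  proof
    assume zero: "x \<bullet> (A *v x) = 0"
    define y where "y = A *v x"
    define q where "q = y \<bullet> (A *v y)"
    have "y \<noteq> 0"
      using \<open>x \<noteq> 0\<close> assms(2) unfolding y_def
      by (metis invertible_def matrix_vector_mul_assoc matrix_vector_mul_lid matrix_vector_mult_0_right)
    then have y: "0 < y \<bullet> y" by simp
    have "0 \<le> 2 * t * (y \<bullet> y) + t\<^sup>2 * q" for t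
    proof -
      have "0 \<le> (x + t *\<^sub>R y) \<bullet> (A *v (x + t *\<^sub>R y))" by (rule nonneg)
      also have "\<dots> = t * (x \<bullet> (A *v y)) + t * (y \<bullet> (A *v x)) + t\<^sup>2 * q"
        by (simp add: matrix_vector_right_distrib matrix_vector_mult_scaleR inner_add_left
            inner_add_right zero q_def power2_eq_square algebra_simps)
      also have "\<dots> = 2 * t * (y \<bullet> y) + t\<^sup>2 * q"
        by (simp add: sym[of x y]) (simp add: y_def)
      finally show ?thesis .
    qed
    \<comment> \<open>small enough for the linear term \<open>- 2 * r * (y \<bullet> y)\<close> to beat the quadratic one\<close>
    moreover define r where "r = (y \<bullet> y) / (q + 1)"
    have q: "0 \<le> q" using nonneg[of y] by (simp add: q_def)
    then have "0 < r" and "y \<bullet> y = r * (q + 1)" using y by (auto simp: r_def)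
    ultimately have "0 \<le> 2 * (- r) * (r * (q + 1)) + (- r)\<^sup>2 * q" by metis
    then have "r\<^sup>2 * (q + 2) \<le> 0" by (simp add: power2_eq_square algebra_simps)
    moreover have "0 < r\<^sup>2 * (q + 2)" using \<open>0 < r\<close> q by (intro mult_pos_pos) auto
    ultimately show False by simp
  qed
  then show ?thesis
    using assms(1) nonneg by (simp add: sym_pos_def_def covariance_matrix_def order_less_le)
qed

lemma nn_integral_exp_neg_norm_sq:
  assumes "0 < s"
  shows "(\<integral>\<^sup>+ x. ennreal (exp (- ((x :: 'a::euclidean_space) \<bullet> x) / (2 * s\<^sup>2))) \<partial>lborel)
       = ennreal (sqrt (2 * pi * s\<^sup>2) ^ DIM('a))"
proof -
  have one: "(\<integral>\<^sup>+ t. ennreal (exp (- t\<^sup>2 / (2 * s\<^sup>2))) \<partial>lborel) = ennreal (sqrt (2 * pi * s\<^sup>2))"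
  proof -
    interpret prob_space "density lborel (normal_density 0 s)"
      using assms by (rule prob_space_normal_density)
    have "(\<integral>\<^sup>+ t. ennreal (normal_density 0 s t) \<partial>lborel) = 1"
      using emeasure_space_1 by (simp add: emeasure_density)
    moreover have "(\<integral>\<^sup>+ t. ennreal (exp (- t\<^sup>2 / (2 * s\<^sup>2))) \<partial>lborel)
        = (\<integral>\<^sup>+ t. ennreal (sqrt (2 * pi * s\<^sup>2)) * ennreal (normal_density 0 s t) \<partial>lborel)"
      using assms by (intro nn_integral_cong) (simp add: normal_density_def flip: ennreal_mult)
    ultimately show ?thesis by (simp add: nn_integral_cmult)
  qed
  have "(\<integral>\<^sup>+ x. ennreal (exp (- ((x :: 'a) \<bullet> x) / (2 * s\<^sup>2))) \<partial>lborel)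
      = (\<integral>\<^sup>+ x. (\<Prod>b\<in>Basis. ennreal (exp (- ((x :: 'a) \<bullet> b)\<^sup>2 / (2 * s\<^sup>2)))) \<partial>lborel)"
  proof (intro nn_integral_cong)
    fix x :: 'a
    have "- (x \<bullet> x) / (2 * s\<^sup>2) = (\<Sum>b\<in>Basis. - (x \<bullet> b)\<^sup>2 / (2 * s\<^sup>2))"
      by (subst euclidean_inner) (simp add: power2_eq_square sum_negf flip: sum_divide_distrib)
    then show "ennreal (exp (- (x \<bullet> x) / (2 * s\<^sup>2))) = (\<Prod>b\<in>Basis. ennreal (exp (- (x \<bullet> b)\<^sup>2 / (2 * s\<^sup>2))))"
      by (simp add: exp_sum prod_ennreal)
  qed
  also have "\<dots> = (\<Prod>b\<in>(Basis :: 'a set). \<integral>\<^sup>+ t. ennreal (exp (- t\<^sup>2 / (2 * s\<^sup>2))) \<partial>lborel)"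
    by (rule nn_integral_lborel_prod) auto
  also have "\<dots> = ennreal (sqrt (2 * pi * s\<^sup>2) ^ DIM('a))"
    unfolding one by (simp add: ennreal_power)
  finally show ?thesis .
qed

lemma gaussian_density_measurable [measurable]:
  "gaussian_density A \<in> borel_measurable borel"
proof -
  have [measurable]: "(\<lambda>x. matrix_inv A *v x) \<in> borel_measurable borel"
    by (intro linear_borel_measurable) auto
  show ?thesis unfolding gaussian_density_def by measurable
qed

lemma gaussian_density_pos: "sym_pos_def A \<Longrightarrow> 0 < gaussian_density A x"
  using sym_pos_def_det_pos[of A] by (simp add: gaussian_density_def)

text \<open>Every centered non-degenerate Gaussian is a linear image of the standard one. The constant is the standard
  normalization, since \<open>\<bar>det V\<bar> = sqrt (det A)\<close> cancels the determinant in the density.\<close>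

lemma nn_integral_gaussian_standardize:
  fixes A :: "real^'n^'n"
  assumes A: "sym_pos_def A"
  shows "\<exists>V :: real^'n^'n. \<forall>h \<in> borel_measurable borel.
      (\<integral>\<^sup>+ x. h x \<partial>gaussian A)
      = ennreal (1 / sqrt ((2 * pi) ^ CARD('n)))
          * (\<integral>\<^sup>+ y. ennreal (exp (- (y \<bullet> y) / 2)) * h (V *v y) \<partial>lborel)"
proof -
  let ?P = "matrix_inv A"
  obtain V :: "real^'n^'n" where V: "transpose V ** ?P ** V = mat 1"
    using sym_pos_def_conjugate_identity[OF sym_pos_def_inverse(1)[OF A]] by blast
  then have "det (transpose V ** ?P ** V) = 1" by simp
  then have det: "(det V)\<^sup>2 = det A"
    using sym_pos_def_inverse(2)[OF A] sym_pos_def_det_pos[OF A]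
    by (simp add: det_mul power2_eq_square field_simps)
  then have detV: "det V \<noteq> 0" using sym_pos_def_det_pos[OF A] by auto
  have abs: "\<bar>det V\<bar> = sqrt (det A)" by (simp flip: det)
  have quad: "(V *v y) \<bullet> (?P *v (V *v y)) = y \<bullet> y" for y
  proof -
    have "(V *v y) \<bullet> (?P *v (V *v y)) = y \<bullet> ((transpose V ** ?P ** V) *v y)"
      by (simp add: dot_lmul_matrix vector_transpose_matrix matrix_vector_mul_assoc
          flip: matrix_mul_assoc)
        (metis dot_lmul_matrix matrix_vector_mul_assoc vector_transpose_matrix transpose_transpose)
    then show ?thesis using V by simp
  qed
  have [measurable]: "(\<lambda>x. V *v x) \<in> borel_measurable borel"
    by (intro linear_borel_measurable) auto
  show ?thesis
  proof (intro exI[of _ V] ballI)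
    fix h :: "real^'n \<Rightarrow> ennreal" assume [measurable]: "h \<in> borel_measurable borel"
    have "(\<integral>\<^sup>+ x. h x \<partial>gaussian A) = (\<integral>\<^sup>+ x. ennreal (gaussian_density A x) * h x \<partial>lborel)"
      by (simp add: gaussian_def nn_integral_density)
    also have "\<dots> = ennreal \<bar>det (matrix ((*v) V))\<bar>
        * (\<integral>\<^sup>+ y. ennreal (gaussian_density A (V *v y)) * h (V *v y) \<partial>lborel)"
      by (rule nn_integral_lborel_linear) (auto simp: detV)
    also have "\<dots> = (\<integral>\<^sup>+ y. ennreal (sqrt (det A)) * (ennreal (gaussian_density A (V *v y)) * h (V *v y)) \<partial>lborel)"
      by (simp add: abs nn_integral_cmult)
    also have "\<dots> = (\<integral>\<^sup>+ y. ennreal (1 / sqrt ((2 * pi) ^ CARD('n)))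
                            * (ennreal (exp (- (y \<bullet> y) / 2)) * h (V *v y)) \<partial>lborel)"
    proof (rule nn_integral_cong)
      fix y :: "real^'n"
      have "sqrt (det A) * gaussian_density A (V *v y)
          = 1 / sqrt ((2 * pi) ^ CARD('n)) * exp (- (y \<bullet> y) / 2)"
        using sym_pos_def_det_pos[OF A] by (simp add: gaussian_density_def quad real_sqrt_mult)
      then have "ennreal (sqrt (det A)) * ennreal (gaussian_density A (V *v y))
          = ennreal (1 / sqrt ((2 * pi) ^ CARD('n))) * ennreal (exp (- (y \<bullet> y) / 2))"
        using gaussian_density_pos[OF A, of "V *v y"] sym_pos_def_det_pos[OF A]
        by (simp flip: ennreal_mult)
      then show "ennreal (sqrt (det A)) * (ennreal (gaussian_density A (V *v y)) * h (V *v y))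
          = ennreal (1 / sqrt ((2 * pi) ^ CARD('n))) * (ennreal (exp (- (y \<bullet> y) / 2)) * h (V *v y))"
        by (simp flip: mult.assoc)
    qed
    also have "\<dots> = ennreal (1 / sqrt ((2 * pi) ^ CARD('n)))
          * (\<integral>\<^sup>+ y. ennreal (exp (- (y \<bullet> y) / 2)) * h (V *v y) \<partial>lborel)"
      by (simp add: nn_integral_cmult)
    finally show "(\<integral>\<^sup>+ x. h x \<partial>gaussian A) = ennreal (1 / sqrt ((2 * pi) ^ CARD('n)))
          * (\<integral>\<^sup>+ y. ennreal (exp (- (y \<bullet> y) / 2)) * h (V *v y) \<partial>lborel)" .
  qed
qed

lemma prob_space_gaussian:
  fixes A :: "real^'n^'n"
  assumes "sym_pos_def A"
  shows "prob_space (gaussian A)"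
proof (rule prob_spaceI)
  obtain V :: "real^'n^'n" where V: "\<And>h. h \<in> borel_measurable borel \<Longrightarrow>
      (\<integral>\<^sup>+ x. h x \<partial>gaussian A)
      = ennreal (1 / sqrt ((2 * pi) ^ CARD('n)))
          * (\<integral>\<^sup>+ y. ennreal (exp (- (y \<bullet> y) / 2)) * h (V *v y) \<partial>lborel)"
    using nn_integral_gaussian_standardize[OF assms] by blast
  have "emeasure (gaussian A) (space (gaussian A)) = (\<integral>\<^sup>+ x. 1 \<partial>gaussian A)"
    by simp
  also have "\<dots> = ennreal (1 / sqrt ((2 * pi) ^ CARD('n)))
      * (\<integral>\<^sup>+ y. ennreal (exp (- ((y :: real^'n) \<bullet> y) / 2)) \<partial>lborel)"
    by (subst V) auto
  also have "\<dots> = 1"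
    using nn_integral_exp_neg_norm_sq[of 1, where 'a = "real^'n"]
    unfolding real_sqrt_power by (simp flip: ennreal_mult)
  finally show "emeasure (gaussian A) (space (gaussian A)) = 1" .
qed

text \<open>After standardization, \<open>t \<le> 4 exp (t / 4)\<close> absorbs the factor \<open>y \<bullet> y\<close> into a Gaussian of twice
  the variance, whose total mass is known.\<close>

lemma gaussian_second_moment_finite:
  fixes A :: "real^'n^'n"
  assumes "sym_pos_def A"
  shows "(\<integral>\<^sup>+ x. ennreal ((norm x)\<^sup>2) \<partial>gaussian A) < \<infinity>"
proof -
  obtain V :: "real^'n^'n" where V: "\<And>h. h \<in> borel_measurable borel \<Longrightarrow>
      (\<integral>\<^sup>+ x. h x \<partial>gaussian A)
      = ennreal (1 / sqrt ((2 * pi) ^ CARD('n)))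
          * (\<integral>\<^sup>+ y. ennreal (exp (- (y \<bullet> y) / 2)) * h (V *v y) \<partial>lborel)"
    using nn_integral_gaussian_standardize[OF assms] by blast
  define K where "K = onorm ((*v) V)"
  have K: "norm (V *v y) \<le> K * norm y" for y
    unfolding K_def by (intro onorm) (simp add: matrix_vector_mul_bounded_linear)
  have bound: "exp (- (y \<bullet> y) / 2) * (norm (V *v y))\<^sup>2 \<le> 4 * K\<^sup>2 * exp (- (y \<bullet> y) / (2 * (sqrt 2)\<^sup>2))"
    for y
  proof -
    have "(norm (V *v y))\<^sup>2 \<le> (K * norm y)\<^sup>2" using K by (intro power_mono) auto
    also have "\<dots> = K\<^sup>2 * (y \<bullet> y)" by (simp add: power_mult_distrib power2_norm_eq_inner)
    also have "y \<bullet> y \<le> 4 * exp ((y \<bullet> y) / 4)"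
      using exp_ge_add_one_self[of "(y \<bullet> y) / 4"] by linarith
    then have "K\<^sup>2 * (y \<bullet> y) \<le> K\<^sup>2 * (4 * exp ((y \<bullet> y) / 4))"
      by (intro mult_left_mono) auto
    finally have "exp (- (y \<bullet> y) / 2) * (norm (V *v y))\<^sup>2
        \<le> exp (- (y \<bullet> y) / 2) * (K\<^sup>2 * (4 * exp ((y \<bullet> y) / 4)))"
      by (intro mult_left_mono) auto
    also have "\<dots> = 4 * K\<^sup>2 * (exp (- (y \<bullet> y) / 2) * exp ((y \<bullet> y) / 4))" by simp
    also have "exp (- (y \<bullet> y) / 2) * exp ((y \<bullet> y) / 4) = exp (- (y \<bullet> y) / (2 * (sqrt 2)\<^sup>2))"
      by (simp flip: exp_add)
    finally show ?thesis .
  qed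
  have "(\<integral>\<^sup>+ y. ennreal (exp (- (y \<bullet> y) / 2)) * ennreal ((norm (V *v y))\<^sup>2) \<partial>lborel)
      \<le> (\<integral>\<^sup>+ y. ennreal (4 * K\<^sup>2) * ennreal (exp (- ((y :: real^'n) \<bullet> y) / (2 * (sqrt 2)\<^sup>2))) \<partial>lborel)"
    using bound by (intro nn_integral_mono) (simp flip: ennreal_mult add: ennreal_leI)
  also have "\<dots> < \<infinity>"
    using nn_integral_exp_neg_norm_sq[of "sqrt 2", where 'a = "real^'n"]
    by (simp add: nn_integral_cmult ennreal_mult_less_top)
  finally show ?thesis by (subst V) (auto simp: ennreal_mult_less_top)
qed

text \<open>The quadratic growth of log-densities is what reduces the finiteness of relative entropies
  between Gaussians to second moments.\<close>

lemma ln_gaussian_density_growth: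
  fixes A :: "real^'n^'n"
  assumes "sym_pos_def A"
  obtains K where "0 \<le> K" "\<And>x. \<bar>ln (gaussian_density A x)\<bar> \<le> K * (1 + (norm x)\<^sup>2)"
proof -
  let ?P = "matrix_inv A"
  define L where "L = onorm ((*v) ?P)"
  define c where "c = ln (sqrt ((2 * pi) ^ CARD('n) * det A))"
  have L: "norm (?P *v x) \<le> L * norm x" for x
    unfolding L_def by (intro onorm) (simp add: matrix_vector_mul_bounded_linear)
  have L0: "0 \<le> L" unfolding L_def by (intro onorm_pos_le) (simp add: matrix_vector_mul_bounded_linear)
  show ?thesis
  proof (rule that[of "\<bar>c\<bar> + L"])
    fix x
    have "ln (gaussian_density A x) = - (x \<bullet> (?P *v x)) / 2 - c"
      using sym_pos_def_det_pos[OF assms] unfolding gaussian_density_def c_def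
      by (subst ln_div) auto
    then have "\<bar>ln (gaussian_density A x)\<bar> \<le> \<bar>x \<bullet> (?P *v x)\<bar> + \<bar>c\<bar>" by linarith
    also have "\<bar>x \<bullet> (?P *v x)\<bar> \<le> norm x * norm (?P *v x)" by (rule Cauchy_Schwarz_ineq2)
    also have "\<dots> \<le> norm x * (L * norm x)" using L by (intro mult_left_mono) auto
    finally have "\<bar>ln (gaussian_density A x)\<bar> \<le> L * (norm x)\<^sup>2 + \<bar>c\<bar>"
      by (simp add: power2_eq_square mult_ac)
    also have "\<dots> \<le> (\<bar>c\<bar> + L) * (1 + (norm x)\<^sup>2)"
      using L0 by (simp add: algebra_simps)
    finally show "\<bar>ln (gaussian_density A x)\<bar> \<le> (\<bar>c\<bar> + L) * (1 + (norm x)\<^sup>2)" .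
  qed (use L0 in simp)
qed

section \<open>Gaussian marginals and a Gaussian reference measure\<close>

text \<open>The inverse of \<^const>\<open>split_vec\<close>; it transports the density of \<^term>\<open>gaussian S\<close> to the
  product space.\<close>

definition join_vec :: "(real^'d) \<times> (real^'d) \<Rightarrow> real^('d::finite + 'd)" where
  "join_vec p = (\<chi> i. case i of Inl a \<Rightarrow> fst p $ a | Inr b \<Rightarrow> snd p $ b)"

lemma join_vec_split_vec [simp]: "join_vec (split_vec z) = z"
  by (simp add: join_vec_def split_vec_def vec_eq_iff split: sum.split)

lemma norm_join_vec: "(norm (join_vec p))\<^sup>2 = (norm (fst p))\<^sup>2 + (norm (snd p))\<^sup>2"
proof -
  have "(norm (join_vec p))\<^sup>2 = (\<Sum>i\<in>UNIV <+> UNIV. (join_vec p $ i)\<^sup>2)"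
    unfolding power2_norm_eq_inner inner_vec_def by (simp add: power2_eq_square)
  also have "\<dots> = (norm (fst p))\<^sup>2 + (norm (snd p))\<^sup>2"
    unfolding power2_norm_eq_inner inner_vec_def
    by (subst sum.Plus) (simp_all add: join_vec_def power2_eq_square)
  finally show ?thesis .
qed

lemma linear_split_vec: "linear split_vec"
  by (rule linearI) (simp_all add: split_vec_def vec_eq_iff)

lemma linear_join_vec: "linear join_vec"
  by (rule linearI) (simp_all add: join_vec_def vec_eq_iff split: sum.split)

lemma distr_lborel_split_vec:
  "distr lborel borel split_vec = (lborel :: ((real^'d::finite) \<times> (real^'d)) measure)"
proof (rule distr_lborel_basis_bij[OF linear_split_vec])
  have axis_l: "split_vec (axis (Inl i) 1) = (axis i 1, 0)" for i :: 'd
    by (simp add: split_vec_def axis_def vec_eq_iff)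
  have axis_r: "split_vec (axis (Inr i) 1) = (0, axis i 1)" for i :: 'd
    by (simp add: split_vec_def axis_def vec_eq_iff)
  have "inj split_vec" by (metis injI join_vec_split_vec)
  then have "inj_on split_vec (Basis :: (real^('d + 'd)) set)" by (rule inj_on_subset) simp
  moreover have "split_vec ` (Basis :: (real^('d + 'd)) set) = Basis"
  proof -
    have "split_vec ` (Basis :: (real^('d + 'd)) set)
        = (\<lambda>i. split_vec (axis i 1)) ` (range Inl \<union> range Inr)"
      by (simp add: Basis_vec_axis image_image UNIV_sum)
    also have "\<dots> = range (\<lambda>i. (axis i 1, 0)) \<union> range (\<lambda>i. (0, axis i 1))"
      by (simp add: image_Un image_image axis_l axis_r)
    also have "\<dots> = Basis"
      by (simp add: Basis_prod_def Basis_vec_axis image_image)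
    finally show ?thesis .
  qed
  ultimately show "bij_betw split_vec (Basis :: (real^('d + 'd)) set) Basis"
    by (simp add: bij_betw_def)
qed

lemma gaussian_pair_eq_density:
  "gaussian_pair S = density lborel (\<lambda>z. ennreal (gaussian_density S (join_vec z)))"
proof -
  have [measurable]: "split_vec \<in> borel_measurable borel" "join_vec \<in> borel_measurable borel"
    by (simp_all add: linear_borel_measurable linear_split_vec linear_join_vec)
  have "density (distr lborel borel split_vec) (\<lambda>z. ennreal (gaussian_density S (join_vec z)))
      = distr (density lborel (\<lambda>z. ennreal (gaussian_density S (join_vec (split_vec z))))) borel split_vec"
    by (rule density_distr) measurable
  then show ?thesis
    by (simp add: distr_lborel_split_vec gaussian_pair_def gaussian_def)
qed

lemma prob_space_gaussian_pair:
  assumes "sym_pos_def S"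
  shows "prob_space (gaussian_pair S)"
proof -
  interpret prob_space "gaussian S" using assms by (rule prob_space_gaussian)
  have "split_vec \<in> gaussian S \<rightarrow>\<^sub>M borel"
    using linear_borel_measurable[OF linear_split_vec] by (simp add: gaussian_def)
  then show ?thesis unfolding gaussian_pair_def by (rule prob_space_distr)
qed

lemma pair_measure_in_couplings:
  assumes "prob_space \<mu>" "prob_space \<nu>"
  shows "\<mu> \<Otimes>\<^sub>M \<nu> \<in> couplings \<mu> \<nu>"
proof -
  interpret \<mu>: prob_space \<mu> by fact
  interpret \<nu>: prob_space \<nu> by fact
  interpret P: pair_prob_space \<mu> \<nu> ..
  have "distr (\<mu> \<Otimes>\<^sub>M \<nu>) \<mu> fst = \<mu>" by (rule \<nu>.distr_pair_fst)
  moreover have "distr (\<mu> \<Otimes>\<^sub>M \<nu>) \<nu> snd = \<nu>"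
  proof (intro measure_eqI)
    fix E assume "E \<in> sets (distr (\<mu> \<Otimes>\<^sub>M \<nu>) \<nu> snd)"
    then have E: "E \<in> sets \<nu>" by simp
    have "snd -` E \<inter> space (\<mu> \<Otimes>\<^sub>M \<nu>) = space \<mu> \<times> E"
      using sets.sets_into_space[OF E] by (auto simp: space_pair_measure)
    then show "emeasure (distr (\<mu> \<Otimes>\<^sub>M \<nu>) \<nu> snd) E = emeasure \<nu> E"
      using E by (simp add: emeasure_distr \<nu>.emeasure_pair_measure_Times \<mu>.emeasure_space_1)
  qed simp
  ultimately show ?thesis
    using P.prob_space_axioms by (simp add: couplings_def)
qed

text \<open>Since \<open>f ln f \<le> f \<bar>ln f\<bar>\<close>, finiteness of the functional at \<open>f\<close> follows from that of an integral
  against the measure with density \<open>f\<close>, where moments are available.\<close>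

lemma penalized_integral_finite:
  fixes c :: "'a \<Rightarrow> real"
  assumes r: "prob_space r" and f: "prob_density r f" and k: "0 < k"
    and c: "c \<in> borel_measurable r" "\<And>z. 0 \<le> c z"
    and g: "g \<in> borel_measurable r" "\<And>z. c z + k * \<bar>ln (f z)\<bar> \<le> g z"
    and fin: "(\<integral>\<^sup>+ z. ennreal (g z) \<partial>density r (\<lambda>z. ennreal (f z))) < \<infinity>"
  shows "penalized_integral k c r f < \<infinity>"
proof -
  interpret prob_space r by fact
  have [measurable]: "f \<in> borel_measurable r" "g \<in> borel_measurable r" and f0: "\<And>z. 0 \<le> f z"
    using f g by (auto simp: prob_density_def)
  have g0: "0 \<le> g z" for z
    by (rule order_trans[OF _ g(2)]) (use c(2) k in auto)
  have "penalized_integral k c r f \<le> (\<integral>\<^sup>+ z. ennreal (f z) * ennreal (g z) + ennreal k \<partial>r)"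
    unfolding penalized_integral_def
  proof (rule nn_integral_mono)
    fix z
    have "k * (f z * ln (f z)) \<le> k * (f z * \<bar>ln (f z)\<bar>)"
      using k f0[of z] by (intro mult_left_mono) auto
    moreover have "0 \<le> k * f z" using k f0[of z] by simp
    ultimately have "c z * f z + k * entropy_fun (f z) \<le> f z * (c z + k * \<bar>ln (f z)\<bar>) + k"
      by (simp add: entropy_fun_def algebra_simps)
    also have "\<dots> \<le> f z * g z + k"
      using f0[of z] g(2)[of z] by (intro add_right_mono mult_left_mono)
    finally have "ennreal (c z * f z + k * entropy_fun (f z)) \<le> ennreal (f z * g z + k)"
      by (rule ennreal_leI)
    also have "\<dots> = ennreal (f z) * ennreal (g z) + ennreal k"
      using f0[of z] g0[of z] k by (simp add: ennreal_plus ennreal_mult)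
    finally show "ennreal (c z * f z + k * entropy_fun (f z)) \<le> ennreal (f z) * ennreal (g z) + ennreal k" .
  qed
  also have "\<dots> = (\<integral>\<^sup>+ z. ennreal (g z) \<partial>density r (\<lambda>z. ennreal (f z))) + ennreal k"
    by (simp add: nn_integral_add nn_integral_density emeasure_space_1)
  also have "\<dots> < \<infinity>" using fin by simp
  finally show ?thesis .
qed

text \<open>The independent coupling is the feasible competitor. Its log-density relative to
  \<^term>\<open>gaussian_pair S\<close> is a signed sum of three log-densities of Gaussians, so cost and log-density are
  dominated by \<open>K (1 + \<parallel>x\<parallel>\<^sup>2 + \<parallel>y\<parallel>\<^sup>2)\<close>, which is integrable against a product of Gaussians.\<close>

lemma gaussian_product_cost_finite:
  fixes S :: "real^('d::finite + 'd)^('d + 'd)" and A B :: "real^'d^'d"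
  assumes S: "sym_pos_def S" and A: "sym_pos_def A" and B: "sym_pos_def B" and \<epsilon>: "0 < \<epsilon>"
  shows "regularized_cost \<epsilon> (gaussian_pair S) (gaussian A \<Otimes>\<^sub>M gaussian B) < \<infinity>"
proof -
  let ?r = "gaussian_pair S"
  let ?\<rho> = "\<lambda>z. gaussian_density S (join_vec z)"
  interpret GA: prob_space "gaussian A" using A by (rule prob_space_gaussian)
  interpret GB: prob_space "gaussian B" using B by (rule prob_space_gaussian)
  interpret P: pair_prob_space "gaussian A" "gaussian B" ..
  have r: "prob_space ?r" using S by (rule prob_space_gaussian_pair)
  have sets_r [measurable_cong]: "sets ?r = sets borel" by (simp add: gaussian_pair_def)
  have sets_G [measurable_cong]: "sets (gaussian A) = sets borel" "sets (gaussian B) = sets borel"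
    by (simp_all add: gaussian_def)
  have [measurable]: "join_vec \<in> borel_measurable borel"
    by (simp add: linear_borel_measurable linear_join_vec)
  have [measurable]: "fst \<in> borel_measurable (borel :: ((real^'d) \<times> (real^'d)) measure)"
    "snd \<in> borel_measurable (borel :: ((real^'d) \<times> (real^'d)) measure)"
    by (intro borel_measurable_continuous_onI continuous_on_fst continuous_on_snd continuous_on_id)+
  define f where "f z = gaussian_density A (fst z) * gaussian_density B (snd z) / ?\<rho> z" for z
  have f_pos: "0 < f z" for z
    by (simp add: f_def gaussian_density_pos A B S)
  have [measurable]: "f \<in> borel_measurable borel" unfolding f_def by measurable
  have prod: "gaussian A \<Otimes>\<^sub>M gaussian B = density ?r (\<lambda>z. ennreal (f z))"
  proof -
    have "gaussian A \<Otimes>\<^sub>M gaussian B = density (lborel \<Otimes>\<^sub>M lborel)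
        (\<lambda>(x, y). ennreal (gaussian_density A x) * ennreal (gaussian_density B y))"
      unfolding gaussian_def
      by (rule pair_measure_density)
        (use GB.sigma_finite_measure_axioms in \<open>auto simp: gaussian_def sigma_finite_lborel\<close>)
    also have "\<dots> = density lborel (\<lambda>z. ennreal (?\<rho> z) * ennreal (f z))"
      unfolding lborel_prod
    proof (intro arg_cong[where f = "density lborel"] ext)
      fix z :: "(real^'d) \<times> (real^'d)"
      have "gaussian_density A (fst z) * gaussian_density B (snd z) = ?\<rho> z * f z"
        using gaussian_density_pos[OF S, of "join_vec z"] by (simp add: f_def)
      then show "(case z of (x, y) \<Rightarrow> ennreal (gaussian_density A x) * ennreal (gaussian_density B y))
          = ennreal (?\<rho> z) * ennreal (f z)"
        using f_pos[of z]
        by (simp add: split_beta' gaussian_density_pos[THEN less_imp_le] A B S flip: ennreal_mult)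
    qed
    also have "\<dots> = density ?r (\<lambda>z. ennreal (f z))"
      unfolding gaussian_pair_eq_density by (rule density_density_eq[symmetric]) measurable
    finally show ?thesis .
  qed
  have f: "prob_density ?r f"
  proof -
    have "emeasure (density ?r (\<lambda>z. ennreal (f z))) (space ?r) = 1"
      using P.emeasure_space_1 by (simp add: prod)
    then show ?thesis
      using f_pos by (simp add: prob_density_def emeasure_density less_imp_le)
  qed
  obtain KA where KA: "0 \<le> KA" "\<And>x. \<bar>ln (gaussian_density A x)\<bar> \<le> KA * (1 + (norm x)\<^sup>2)"
    using ln_gaussian_density_growth[OF A] by blast
  obtain KB where KB: "0 \<le> KB" "\<And>x. \<bar>ln (gaussian_density B x)\<bar> \<le> KB * (1 + (norm x)\<^sup>2)"
    using ln_gaussian_density_growth[OF B] by blast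
  obtain KS where KS: "0 \<le> KS" "\<And>x. \<bar>ln (gaussian_density S x)\<bar> \<le> KS * (1 + (norm x)\<^sup>2)"
    using ln_gaussian_density_growth[OF S] by blast
  define K where "K = 2 + 2 * \<epsilon> * (KA + KB + KS)"
  define q where "q z = 1 + ((norm (fst z))\<^sup>2 + (norm (snd z))\<^sup>2)" for z :: "(real^'d) \<times> (real^'d)"
  have K0: "0 \<le> K" using KA(1) KB(1) KS(1) \<epsilon> by (simp add: K_def)
  have [measurable]: "q \<in> borel_measurable borel" unfolding q_def by measurable
  have bound: "transport_cost z + 2 * \<epsilon> * \<bar>ln (f z)\<bar> \<le> K * q z" for z
  proof -
    have "transport_cost z \<le> (norm (fst z) + norm (snd z))\<^sup>2"
      unfolding transport_cost_def by (intro power_mono norm_triangle_ineq4) auto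
    also have "\<dots> \<le> 2 * ((norm (fst z))\<^sup>2 + (norm (snd z))\<^sup>2)"
      using zero_le_power2[of "norm (fst z) - norm (snd z)"]
      by (simp add: power2_eq_square algebra_simps)
    also have "\<dots> \<le> 2 * q z" by (simp add: q_def)
    finally have cost: "transport_cost z \<le> 2 * q z" .
    have "ln (f z) = ln (gaussian_density A (fst z)) + ln (gaussian_density B (snd z)) - ln (?\<rho> z)"
      using gaussian_density_pos[OF A, of "fst z"] gaussian_density_pos[OF B, of "snd z"]
        gaussian_density_pos[OF S, of "join_vec z"]
      by (simp add: f_def ln_mult_pos ln_divide_pos)
    then have "\<bar>ln (f z)\<bar> \<le> KA * (1 + (norm (fst z))\<^sup>2) + KB * (1 + (norm (snd z))\<^sup>2) + KS * q z"
      using KA(2)[of "fst z"] KB(2)[of "snd z"] KS(2)[of "join_vec z"]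
      unfolding norm_join_vec q_def by linarith
    also have "\<dots> \<le> KA * q z + KB * q z + KS * q z"
      using KA(1) KB(1) KS(1) by (intro add_mono mult_left_mono) (auto simp: q_def)
    finally have "2 * \<epsilon> * \<bar>ln (f z)\<bar> \<le> 2 * \<epsilon> * (KA * q z + KB * q z + KS * q z)"
      using \<epsilon> by (intro mult_left_mono) auto
    with cost show ?thesis by (simp add: K_def algebra_simps)
  qed
  have "(\<integral>\<^sup>+ z. ennreal (K * q z) \<partial>(gaussian A \<Otimes>\<^sub>M gaussian B))
      = (\<integral>\<^sup>+ x. \<integral>\<^sup>+ y. ennreal K * (1 + (ennreal ((norm x)\<^sup>2) + ennreal ((norm y)\<^sup>2))) \<partial>gaussian B \<partial>gaussian A)"
    using K0
    by (subst GB.nn_integral_fst[symmetric])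
      (auto simp: q_def ennreal_mult ennreal_plus)
  also have "\<dots> = ennreal K * (1 + ((\<integral>\<^sup>+ x. ennreal ((norm x)\<^sup>2) \<partial>gaussian A) + (\<integral>\<^sup>+ y. ennreal ((norm y)\<^sup>2) \<partial>gaussian B)))"
    by (simp add: nn_integral_cmult nn_integral_add GA.emeasure_space_1 GB.emeasure_space_1)
  also have "\<dots> < \<infinity>"
    using gaussian_second_moment_finite[OF A] gaussian_second_moment_finite[OF B]
    by (simp add: ennreal_mult_less_top)
  finally have fin: "(\<integral>\<^sup>+ z. ennreal (K * q z) \<partial>density ?r (\<lambda>z. ennreal (f z))) < \<infinity>"
    by (simp add: prod)
  have "penalized_integral (2 * \<epsilon>) transport_cost ?r f < \<infinity>"
  proof (rule penalized_integral_finite[OF r f _ _ _ _ bound fin])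
    show "transport_cost \<in> borel_measurable ?r" "(\<lambda>z. K * q z) \<in> borel_measurable ?r"
      by measurable
  qed (use \<epsilon> in \<open>auto simp: transport_cost_def\<close>)
  then show ?thesis
    unfolding prod regularized_cost_density[OF r sets_r f \<epsilon>]
    by (cases "penalized_integral (2 * \<epsilon>) transport_cost ?r f") auto
qed

theorem lemma2p1:
  fixes S :: "real^('d::finite + 'd)^('d + 'd)"
    and A B :: "real^'d^'d"
    and \<epsilon> :: real
  assumes "sym_pos_def S"
    and "\<epsilon> > 0"
    and "covariance_matrix A" and "invertible A"
    and "covariance_matrix B" and "invertible B"
  shows "\<exists>!p. is_arg_min (regularized_cost \<epsilon> (gaussian_pair S))
                (\<lambda>p. p \<in> couplings (gaussian A) (gaussian B)) p"
proof (rule entropic_transport_unique_minimizer)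
  have A: "sym_pos_def A" and B: "sym_pos_def B"
    using assms by (auto intro: covariance_matrix_invertible_imp_sym_pos_def)
  show "prob_space (gaussian_pair S)" using assms(1) by (rule prob_space_gaussian_pair)
  show "gaussian A \<Otimes>\<^sub>M gaussian B \<in> couplings (gaussian A) (gaussian B)"
    by (intro pair_measure_in_couplings prob_space_gaussian A B)
  show "regularized_cost \<epsilon> (gaussian_pair S) (gaussian A \<Otimes>\<^sub>M gaussian B) < \<infinity>"
    by (rule gaussian_product_cost_finite[OF assms(1) A B assms(2)])
qed (use assms in \<open>auto simp: gaussian_def gaussian_pair_def\<close>)

end
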